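(* Let $n\ge2$, let $X_1,\dots,X_n$ be Banach spaces and $D_k\in\mathcal{B}(X_k)$, and assume that $D_s-\lambda$ satisfies the complements condition for all $2\le s\le n-1$ and all $\lambda\in\mathbb{C}$. Then for every $A\in\mathcal{B}_n$, $$\bigcup_{k=1}^n\sigma_{le}(D_k)=\sigma_{le}(T_n^d(A))\cup\Delta_1\cup\Delta_2,$$ where $$\Delta_1=\bigcup_{k=2}^{n}\Big\{\lambda:\ \alpha(D_k-\lambda)=\infty,\ \alpha(D_s-\lambda)<\infty\text{ for }2\le s\le k-1,\ \sum_{s=1}^{k-1}\beta(D_s-\lambda)=\infty\Big\}\cap\rho_{le}(D_1)$$ (for $k=2$ the condition on $2\le s\le k-1$ is vacuous), and $$\Delta_2=\bigcup_{k=1}^{n}\Big\{\lambda:\ \alpha(D_s-\lambda)<\infty\text{ for all }s=1,\dots,n,\ \text{and } \mathcal{R}(D_k-\lambda)\text{ is not (closed and) complemented}\Big\}.$$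
   Context: For a bounded operator $T$ between Banach spaces, $\alpha(T)=\dim\mathcal{N}(T)$, $\beta(T)=\operatorname{codim}\mathcal{R}(T)$, values in $\{0,1,\dots\}\cup\{\infty\}$, sums taken in this extended set. $T\in\mathcal{B}(X,Y)$ satisfies the complements condition if $\mathcal{N}(T)$ is topologically complemented in $X$ and $\overline{\mathcal{R}(T)}$ is topologically complemented in $Y$. $T$ is left Fredholm if $\alpha(T)<\infty$ and $\mathcal{R}(T)$ is closed and complemented; $\sigma_{le}(T)=\{\lambda\in\mathbb{C}:\lambda-T$ not left Fredholm$\}$, $\rho_{le}=\mathbb{C}\setminus\sigma_{le}$. $\mathcal{B}_n$ is the set of tuples $A=(A_{ij})_{1\le i<j\le n}$, $A_{ij}\in\mathcal{B}(X_j,X_i)$; $T_n^d(A)$ is the upper triangular operator matrix on $X_1\oplus\cdots\oplus X_n$ with diagonal $D_1,\dots,D_n$, entries $A_{ij}$ above the diagonal and zeros below. *)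

theory Defs
  imports "HOL-Analysis.Analysis" "HOL-Library.Extended_Nat"
begin

text \<open>Complex Banach spaces are modelled as closed subspaces of a real Banach type
  equipped with a complex structure J (a bounded real-linear map with J (J x) = - x);
  multiplication by the complex scalar c is  Re c *R x + Im c *R J x.\<close>

definition cstruct :: "('b::real_normed_vector \<Rightarrow> 'b) \<Rightarrow> bool" where
  "cstruct J \<longleftrightarrow> bounded_linear J \<and> (\<forall>x. J (J x) = - x)"

definition cscale :: "('b::real_normed_vector \<Rightarrow> 'b) \<Rightarrow> complex \<Rightarrow> 'b \<Rightarrow> 'b" where
  "cscale J c x = Re c *\<^sub>R x + Im c *\<^sub>R J x"

definition csubspace :: "('b::real_normed_vector \<Rightarrow> 'b) \<Rightarrow> 'b set \<Rightarrow> bool" where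
  "csubspace J V \<longleftrightarrow> subspace V \<and> (\<forall>x\<in>V. J x \<in> V)"

definition cbop :: "('b::real_normed_vector \<Rightarrow> 'b) \<Rightarrow> 'b set \<Rightarrow> 'b set \<Rightarrow> ('b \<Rightarrow> 'b) \<Rightarrow> bool" where
  "cbop J X Y T \<longleftrightarrow> (\<forall>x\<in>X. T x \<in> Y) \<and> (\<forall>x\<in>X. \<forall>y\<in>X. T (x + y) = T x + T y)
     \<and> (\<forall>c::real. \<forall>x\<in>X. T (c *\<^sub>R x) = c *\<^sub>R T x) \<and> (\<forall>x\<in>X. T (J x) = J (T x))
     \<and> (\<exists>K. \<forall>x\<in>X. norm (T x) \<le> K * norm x)"

text \<open>Complex dimension of a complex subspace (real dimension divided by 2), in {0,1,...} \<union> {\<infinity>}.\<close>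
definition cdim :: "'b::real_normed_vector set \<Rightarrow> enat" where
  "cdim V = (if \<exists>B. finite B \<and> V \<subseteq> span B then enat (dim V div 2) else \<infinity>)"

definition codim :: "('b::real_normed_vector \<Rightarrow> 'b) \<Rightarrow> 'b set \<Rightarrow> 'b set \<Rightarrow> enat" where
  "codim J Y R = (INF C\<in>{C. csubspace J C \<and> C \<subseteq> Y \<and> R \<inter> C = {0}
       \<and> (\<forall>y\<in>Y. \<exists>r\<in>R. \<exists>c\<in>C. y = r + c)}. cdim C)"

definition kerOp :: "'b set \<Rightarrow> ('b::real_normed_vector \<Rightarrow> 'b) \<Rightarrow> 'b set" where
  "kerOp X T = {x\<in>X. T x = 0}"

definition alpha :: "'b::real_normed_vector set \<Rightarrow> ('b \<Rightarrow> 'b) \<Rightarrow> enat" where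
  "alpha X T = cdim (kerOp X T)"

definition beta :: "('b::real_normed_vector \<Rightarrow> 'b) \<Rightarrow> 'b set \<Rightarrow> 'b set \<Rightarrow> ('b \<Rightarrow> 'b) \<Rightarrow> enat" where
  "beta J X Y T = codim J Y (T ` X)"

definition complemented :: "('b::real_normed_vector \<Rightarrow> 'b) \<Rightarrow> 'b set \<Rightarrow> 'b set \<Rightarrow> bool" where
  "complemented J X M \<longleftrightarrow> closed M \<and> csubspace J M \<and> M \<subseteq> X \<and>
     (\<exists>N. csubspace J N \<and> closed N \<and> N \<subseteq> X \<and> M \<inter> N = {0} \<and>
          (\<forall>x\<in>X. \<exists>m\<in>M. \<exists>c\<in>N. x = m + c))"

definition complements_condition ::
  "('b::real_normed_vector \<Rightarrow> 'b) \<Rightarrow> 'b set \<Rightarrow> 'b set \<Rightarrow> ('b \<Rightarrow> 'b) \<Rightarrow> bool" where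
  "complements_condition J X Y T \<longleftrightarrow>
     complemented J X (kerOp X T) \<and> complemented J Y (closure (T ` X))"

definition left_fredholm ::
  "('b::real_normed_vector \<Rightarrow> 'b) \<Rightarrow> 'b set \<Rightarrow> 'b set \<Rightarrow> ('b \<Rightarrow> 'b) \<Rightarrow> bool" where
  "left_fredholm J X Y T \<longleftrightarrow> alpha X T < \<infinity> \<and> closed (T ` X) \<and> complemented J Y (T ` X)"

definition sigma_le :: "('b::real_normed_vector \<Rightarrow> 'b) \<Rightarrow> 'b set \<Rightarrow> ('b \<Rightarrow> 'b) \<Rightarrow> complex set" where
  "sigma_le J X T = {z. \<not> left_fredholm J X X (\<lambda>x. cscale J z x - T x)}"

definition rho_le :: "('b::real_normed_vector \<Rightarrow> 'b) \<Rightarrow> 'b set \<Rightarrow> ('b \<Rightarrow> 'b) \<Rightarrow> complex set" where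
  "rho_le J X T = UNIV - sigma_le J X T"

definition shiftOp :: "('b::real_normed_vector \<Rightarrow> 'b) \<Rightarrow> ('b \<Rightarrow> 'b) \<Rightarrow> complex \<Rightarrow> 'b \<Rightarrow> 'b" where
  "shiftOp J D z = (\<lambda>x. D x - cscale J z x)"

definition vecJ :: "('a::real_normed_vector \<Rightarrow> 'a) \<Rightarrow> ('a ^ 'n) \<Rightarrow> ('a ^ 'n)" where
  "vecJ J x = (\<chi> i. J (x $ i))"

definition dirsum :: "('n \<Rightarrow> 'a set) \<Rightarrow> ('a ^ 'n) set" where
  "dirsum X = {x. \<forall>i. x $ i \<in> X i}"

definition triOp :: "('n::{finite,linorder} \<Rightarrow> 'a::real_normed_vector \<Rightarrow> 'a) \<Rightarrow> ('n \<Rightarrow> 'n \<Rightarrow> 'a \<Rightarrow> 'a)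
    \<Rightarrow> ('a, 'n) vec \<Rightarrow> ('a, 'n) vec" where
  "triOp D A x = (\<chi> i. D i (x $ i) + (\<Sum>j\<in>{j. i < j}. A i j (x $ j)))"

end

(*
A bounded operator T is left Fredholm iff it has a bounded left inverse modulo finite rank, i.e.
S T = I - F with F of finite rank. Such an S for a triangular T is obtained from left inverses of
the diagonal entries by back substitution, and conversely the corner of S is a left inverse modulo
finite rank of the first diagonal entry. So if T is left Fredholm, only later diagonal entries can
fail, and outside Delta_2 they fail by having an infinite-dimensional kernel. Take the first such
entry D_k. If all earlier ranges had finite-dimensional complements C_s, every u in the kernel of
D_k would be the k-th entry of an x whose later entries vanish and with T x in the direct sum of
the C_s; but such x form a finite-dimensional space because the kernel of T is finite-dimensional.
*)
theory Submission
  imports Defs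
begin

text \<open>The range of a triangular operator is not assembled from the ranges of its entries, so
  closedness and complementedness cannot be followed through the matrix entry by entry, whereas an
  identity S T = I - F can be composed and compressed. The price is paid in translating between the
  two descriptions. Starting from a closed complemented range, boundedness of S comes from the open
  mapping theorem. In the other direction S is altered so that T S T = T; then T S is a bounded
  projection onto the range, which is therefore closed and complemented. The alteration uses a
  generalized inverse of a finite rank operator, for which Hahn-Banach supplies bounded functionals.
  These functionals are real-linear; complex linearity is recovered by averaging over the complex
  structure. Spaces are subspaces of an ambient type, so operators are meaningful only on their
  carriers, and linearity and boundedness are relative to a set.\<close>

section \<open>Norming functionals\<close>

text \<open>Homogeneity is asked only as an inequality, so that an infimum needs only upper bounds;
  applying it to 1/c gives equality for c > 0.\<close>

definition sublinear :: "('a::real_vector \<Rightarrow> real) \<Rightarrow> bool" where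
  "sublinear p \<longleftrightarrow> (\<forall>x y. p (x + y) \<le> p x + p y) \<and> (\<forall>c\<ge>0. \<forall>x. p (c *\<^sub>R x) \<le> c * p x)"

lemma sublinearD:
  assumes "sublinear p"
  shows "p (x + y) \<le> p x + p y" and "c \<ge> 0 \<Longrightarrow> p (c *\<^sub>R x) \<le> c * p x"
    and "p 0 = 0" and "- p (- x) \<le> p x" and "c \<ge> 0 \<Longrightarrow> p (c *\<^sub>R x) = c * p x"
proof -
  show add: "p (x + y) \<le> p x + p y" for x y
    using assms by (simp add: sublinear_def)
  show scale: "p (c *\<^sub>R x) \<le> c * p x" if "c \<ge> 0" for c x
    using assms that by (simp add: sublinear_def)
  show zero: "p 0 = 0"
    using add[of 0 0] scale[of 0 0] by simp
  show "- p (- x) \<le> p x"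
    using add[of x "- x"] zero by simp
  show "p (c *\<^sub>R x) = c * p x" if "c \<ge> 0"
  proof (cases "c = 0")
    case False
    have "p x \<le> (1 / c) * p (c *\<^sub>R x)"
      using scale[of "1 / c" "c *\<^sub>R x"] that False by simp
    then have "c * p x \<le> p (c *\<^sub>R x)"
      using that False by (simp add: field_simps)
    with scale[OF that, of x] show ?thesis by simp
  qed (simp add: zero)
qed

text \<open>The tilted functional is the infimum over t \<ge> 0 of q(x + t y) - t q(y), which is
  bounded below by -q(-x). The term t = 0 gives the first bound and t = 1 the second. The second
  bound forces additivity of a minimal functional, and for the norm it yields a functional attaining
  its norm at y.\<close>

lemma sublinear_tilt:
  assumes q: "sublinear q"
  shows "\<exists>q'. sublinear q' \<and> (\<forall>x. q' x \<le> q x) \<and> (\<forall>x. q' x \<le> q (x + y) - q y)"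
proof -
  define r where "r x t = q (x + t *\<^sub>R y) - t * q y" for x t
  define q' where "q' x = (INF t\<in>{0..}. r x t)" for x
  have lower: "- q (- x) \<le> r x t" if "t \<ge> 0" for x t
    using sublinearD(1)[OF q, of "x + t *\<^sub>R y" "- x"] sublinearD(5)[OF q that, of y]
    by (simp add: r_def)
  have bdd: "bdd_below (r x ` {0..})" for x
    using lower by (intro bdd_belowI[where m = "- q (- x)"]) auto
  have le: "q' x \<le> r x t" if "t \<ge> 0" for x t
    unfolding q'_def using bdd that by (intro cINF_lower) auto
  have ge: "m \<le> q' x" if "\<And>t. t \<ge> 0 \<Longrightarrow> m \<le> r x t" for m x
    unfolding q'_def using that by (intro cINF_greatest) auto
  have add: "q' (x + z) \<le> q' x + q' z" for x z
  proof -
    have "q' (x + z) \<le> r x s + r z t" if "s \<ge> 0" "t \<ge> 0" for s t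
    proof -
      have "q' (x + z) \<le> r (x + z) (s + t)"
        using le that by simp
      also have "\<dots> \<le> r x s + r z t"
        using sublinearD(1)[OF q, of "x + s *\<^sub>R y" "z + t *\<^sub>R y"]
        by (simp add: r_def algebra_simps)
      finally show ?thesis .
    qed
    then have "q' (x + z) - r x s \<le> q' z" if "s \<ge> 0" for s
      using that by (intro ge) (simp add: algebra_simps)
    then have "q' (x + z) - q' z \<le> q' x"
      by (intro ge) (simp add: algebra_simps)
    then show ?thesis by simp
  qed
  have scale: "q' (c *\<^sub>R x) \<le> c * q' x" if "c \<ge> 0" for c x
  proof (cases "c = 0")
    case True
    then show ?thesis
      using le[of 0 0] sublinearD(3)[OF q] by (simp add: r_def)
  next
    case False
    have "q' (c *\<^sub>R x) / c \<le> r x t" if "t \<ge> 0" for t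
    proof -
      have "q' (c *\<^sub>R x) \<le> r (c *\<^sub>R x) (c * t)"
        using le \<open>c \<ge> 0\<close> that by simp
      also have "\<dots> = c * r x t"
        using sublinearD(5)[OF q \<open>c \<ge> 0\<close>, of "x + t *\<^sub>R y"]
        by (simp add: r_def algebra_simps)
      finally show ?thesis
        using \<open>c \<ge> 0\<close> False by (simp add: field_simps)
    qed
    then have "q' (c *\<^sub>R x) / c \<le> q' x" by (rule ge)
    then show ?thesis
      using \<open>c \<ge> 0\<close> False by (simp add: field_simps)
  qed
  have "sublinear q'"
    using add scale by (simp add: sublinear_def)
  moreover have "q' x \<le> q x" "q' x \<le> q (x + y) - q y" for x
    using le[of 0 x] le[of 1 x] by (auto simp: r_def)
  ultimately show ?thesis by blast
qed

text \<open>A minimal sublinear functional is linear, because tilting cannot decrease it.\<close>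

lemma sublinear_dominates_linear:
  fixes p :: "'a::real_vector \<Rightarrow> real"
  assumes p: "sublinear p"
  shows "\<exists>f. linear f \<and> (\<forall>x. f x \<le> p x)"
proof -
  define A where "A = {q. sublinear q \<and> (\<forall>x. q x \<le> p x)}"
  \<comment> \<open>The order is reversed: a maximal element in the sense of Zorn is a pointwise
    minimal functional, and a chain is bounded by its pointwise infimum.\<close>
  let ?P = "\<lambda>a b :: 'a \<Rightarrow> real. \<forall>x. b x \<le> a x"
  have "\<exists>m\<in>A. \<forall>a\<in>A. ?P m a \<longrightarrow> a = m"
  proof (rule predicate_Zorn)
    show "partial_order_on A (relation_of ?P A)"
      by (rule partial_order_on_relation_ofI) (auto intro: order_trans simp: fun_eq_iff order_antisym)
  next
    fix C assume C: "C \<in> Chains (relation_of ?P A)"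
    then have CA: "C \<subseteq> A" and
      chain: "\<And>a b. a \<in> C \<Longrightarrow> b \<in> C \<Longrightarrow> ?P a b \<or> ?P b a"
      by (auto simp: Chains_def relation_of_def)
    show "\<exists>u\<in>A. \<forall>a\<in>C. ?P a u"
    proof (cases "C = {}")
      case True
      then show ?thesis using p by (auto simp: A_def)
    next
      case False
      define u where "u x = (INF q\<in>C. q x)" for x
      have sub: "sublinear q" and qp: "q x \<le> p x" if "q \<in> C" for q x
        using CA that by (auto simp: A_def)
      \<comment> \<open>A lower bound common to all members of the chain, so the infimum is
        finite.\<close>
      have "- p (- x) \<le> q x" if "q \<in> C" for q x
        using sublinearD(4)[OF sub[OF that], of x] qp[OF that, of "- x"] by simp
      then have bdd: "bdd_below ((\<lambda>q. q x) ` C)" for x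
        by (intro bdd_belowI[where m = "- p (- x)"]) auto
      have le: "u x \<le> q x" if "q \<in> C" for x q
        unfolding u_def using bdd that by (intro cINF_lower) auto
      have ge: "m \<le> u x" if "\<And>q. q \<in> C \<Longrightarrow> m \<le> q x" for m x
        unfolding u_def using that False by (intro cINF_greatest) auto
      have add: "u (x + y) \<le> u x + u y" for x y
      proof -
        have *: "u (x + y) \<le> a x + b y" if ab: "a \<in> C" "b \<in> C" for a b
        proof -
          \<comment> \<open>Two members of a chain are comparable, and the smaller one serves both
            arguments.\<close>
          obtain q where q: "q \<in> C" "q x \<le> a x" "q y \<le> b y"
            using chain[OF ab] ab by blast
          have "u (x + y) \<le> q (x + y)" by (rule le[OF q(1)])
          also have "\<dots> \<le> q x + q y" by (rule sublinearD(1)[OF sub[OF q(1)]])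
          finally show ?thesis using q by simp
        qed
        have "u (x + y) - a x \<le> u y" if "a \<in> C" for a
          using *[OF that] by (intro ge) (simp add: algebra_simps)
        then have "u (x + y) - u y \<le> u x"
          by (intro ge) (simp add: algebra_simps)
        then show ?thesis by simp
      qed
      have scale: "u (c *\<^sub>R x) \<le> c * u x" if "c \<ge> 0" for c x
      proof (cases "c = 0")
        case True
        obtain q where "q \<in> C" using False by blast
        then show ?thesis
          using True le[of q 0] sublinearD(3)[OF sub[of q]] by simp
      next
        case c: False
        have "u (c *\<^sub>R x) / c \<le> q x" if "q \<in> C" for q
          using le[OF that, of "c *\<^sub>R x"] sublinearD(2)[OF sub[OF that] \<open>c \<ge> 0\<close>, of x] \<open>c \<ge> 0\<close> c
          by (simp add: field_simps)
        then have "u (c *\<^sub>R x) / c \<le> u x" by (rule ge)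
        then show ?thesis
          using \<open>c \<ge> 0\<close> c by (simp add: field_simps)
      qed
      obtain q where "q \<in> C" using False by blast
      then have "u x \<le> p x" for x
        using le qp by (blast intro: order_trans)
      then have "u \<in> A"
        using add scale by (simp add: A_def sublinear_def)
      then show ?thesis using le by blast
    qed
  qed
  then obtain m where m: "m \<in> A" and min: "\<And>a. a \<in> A \<Longrightarrow> (\<forall>x. a x \<le> m x) \<Longrightarrow> a = m"
    by blast
  have sub: "sublinear m" and mp: "m x \<le> p x" for x
    using m by (auto simp: A_def)
  have add: "m (x + y) = m x + m y" for x y
  proof -
    obtain q' where q': "sublinear q'" "\<And>x. q' x \<le> m x" "\<And>x. q' x \<le> m (x + y) - m y"
      using sublinear_tilt[OF sub, of y] by blast
    have "q' \<in> A"
      using q' mp by (auto simp: A_def intro: order_trans)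
    then have "q' = m" using min q'(2) by blast
    with q'(3)[of x] sublinearD(1)[OF sub, of x y] show ?thesis by simp
  qed
  have neg: "m (- x) = - m x" for x
    using add[of x "- x"] sublinearD(3)[OF sub] by simp
  have "m (c *\<^sub>R x) = c * m x" for c x
  proof (cases "c \<ge> 0")
    case True
    then show ?thesis by (rule sublinearD(5)[OF sub])
  next
    case False
    then show ?thesis
      using sublinearD(5)[OF sub, of "- c" x] neg[of "c *\<^sub>R x"] by simp
  qed
  then have "linear m"
    using add by (intro linearI) auto
  then show ?thesis using mp by blast
qed

text \<open>Hahn-Banach for one vector. A linear f below the tilt of the norm along y satisfies
  f(-y) \<le> norm 0 - norm y, hence f(y) \<ge> norm y, while f \<le> norm bounds f and gives the
  other inequality.\<close>

lemma norming_functional: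
  fixes y :: "'a::real_normed_vector"
  shows "\<exists>f. bounded_linear f \<and> f y = norm y"
proof -
  have "sublinear (norm :: 'a \<Rightarrow> real)"
    by (simp add: sublinear_def norm_triangle_ineq)
  then obtain q where q: "sublinear q" "\<And>x. q x \<le> norm x" "\<And>x. q x \<le> norm (x + y) - norm y"
    using sublinear_tilt[of norm y] by blast
  obtain f where f: "linear f" "\<And>x. f x \<le> q x"
    using sublinear_dominates_linear[OF q(1)] by blast
  have fn: "f x \<le> norm x" for x
    using f(2) q(2) by (rule order_trans)
  have abs: "norm (f x) \<le> norm x * 1" for x
    using fn[of x] fn[of "- x"] linear_neg[OF f(1), of x] by simp
  have "bounded_linear f"
    using f(1) abs by (intro bounded_linear_intro[where K = 1]) (auto simp: linear_add linear_scale)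
  moreover have "f y = norm y"
    using order_trans[OF f(2) q(3), of "- y"] fn[of y] linear_neg[OF f(1), of y] by simp
  ultimately show ?thesis by blast
qed

section \<open>Linear maps on subspaces\<close>

definition lin_on :: "'a::real_vector set \<Rightarrow> ('a \<Rightarrow> 'b::real_vector) \<Rightarrow> bool" where
  "lin_on V f \<longleftrightarrow> (\<forall>x\<in>V. \<forall>y\<in>V. f (x + y) = f x + f y) \<and> (\<forall>c. \<forall>x\<in>V. f (c *\<^sub>R x) = c *\<^sub>R f x)"

text \<open>This is the test inside \<open>cdim\<close>. The spanning set may lie outside V, and V
  may be any set, so subsets inherit the property at once.\<close>

definition findim :: "'a::real_vector set \<Rightarrow> bool" where
  "findim V \<longleftrightarrow> (\<exists>B. finite B \<and> V \<subseteq> span B)"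

lemma lin_onD:
  assumes "lin_on V f" "subspace V"
  shows "x \<in> V \<Longrightarrow> y \<in> V \<Longrightarrow> f (x + y) = f x + f y"
    and "x \<in> V \<Longrightarrow> f (c *\<^sub>R x) = c *\<^sub>R f x"
    and "f 0 = 0"
    and "x \<in> V \<Longrightarrow> f (- x) = - f x"
    and "x \<in> V \<Longrightarrow> y \<in> V \<Longrightarrow> f (x - y) = f x - f y"
proof -
  show add: "f (x + y) = f x + f y" if "x \<in> V" "y \<in> V" for x y
    using assms that by (simp add: lin_on_def)
  show scale: "f (c *\<^sub>R x) = c *\<^sub>R f x" if "x \<in> V" for c x
    using assms that by (simp add: lin_on_def)
  show "f 0 = 0"
    using scale[of 0 0] subspace_0[OF assms(2)] by simp
  show neg: "f (- x) = - f x" if "x \<in> V" for x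
    using scale[of x "- 1"] that by simp
  show "f (x - y) = f x - f y" if "x \<in> V" "y \<in> V"
    using add[of x "- y"] neg[of y] subspace_neg[OF assms(2)] that by simp
qed

lemma lin_on_subset: "lin_on V f \<Longrightarrow> U \<subseteq> V \<Longrightarrow> lin_on U f"
  unfolding lin_on_def by blast

lemma subspace_image_on:
  assumes V: "subspace V" and f: "lin_on V f"
  shows "subspace (f ` V)"
proof (rule subspaceI)
  show "0 \<in> f ` V"
    using lin_onD(3)[OF f V] subspace_0[OF V] by (metis imageI)
  fix x y assume "x \<in> f ` V" "y \<in> f ` V"
  then show "x + y \<in> f ` V"
    using lin_onD(1)[OF f V] subspace_add[OF V] by (smt (verit) image_iff)
next
  fix c x assume "x \<in> f ` V"
  then show "c *\<^sub>R x \<in> f ` V"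
    using lin_onD(2)[OF f V] subspace_scale[OF V] by (smt (verit) image_iff)
qed

lemma subspace_ker_on:
  assumes V: "subspace V" and f: "lin_on V f"
  shows "subspace {x \<in> V. f x = 0}"
  using lin_onD[OF f V] V by (auto simp: subspace_def)

lemma findim_subset: "findim V \<Longrightarrow> U \<subseteq> V \<Longrightarrow> findim U"
  unfolding findim_def by blast

lemma findim_basis:
  assumes "subspace V" "findim V"
  obtains B where "finite B" "B \<subseteq> V" "span B = V"
proof -
  obtain B0 where B0: "finite B0" "V \<subseteq> span B0"
    using assms(2) by (auto simp: findim_def)
  obtain B where B: "B \<subseteq> V" "independent B" "V \<subseteq> span B"
    by (rule maximal_independent_subset)
  have "finite B"
    using independent_span_bound[OF B0(1) B(2)] B(1) B0(2) by blast
  moreover have "span B = V"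
    using B span_minimal[OF B(1) assms(1)] by blast
  ultimately show ?thesis using that B by blast
qed

text \<open>The induction carries membership in V along, because additivity of f is available only
  there.\<close>

lemma span_image_on:
  assumes V: "subspace V" and f: "lin_on V f" and B: "B \<subseteq> V" and x: "x \<in> span B"
  shows "f x \<in> span (f ` B)"
proof -
  from x have "x \<in> V \<and> f x \<in> span (f ` B)"
  proof (induction rule: span_induct_alt)
    case base
    then show ?case
      using lin_onD(3)[OF f V] subspace_0[OF V] by (simp add: span_0)
  next
    case (step c x y)
    then have "x \<in> V" "y \<in> V" "c *\<^sub>R x \<in> V" using B V by (auto simp: subspace_scale)
    then show ?case
      using step lin_onD(1,2)[OF f V] subspace_add[OF V]
      by (simp add: span_add span_scale span_base)
  qed
  then show ?thesis ..
qed

lemma findim_image: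
  assumes V: "subspace V" and f: "lin_on V f" and fin: "findim V"
  shows "findim (f ` V)"
proof -
  obtain B where "finite B" "B \<subseteq> V" "span B = V"
    by (rule findim_basis[OF V fin])
  then have "finite (f ` B)" "f ` V \<subseteq> span (f ` B)"
    using span_image_on[OF V f] by auto
  then show ?thesis unfolding findim_def by blast
qed

text \<open>Rank-nullity: a spanning set of the image, lifted to V, spans V together with a spanning
  set of the kernel.\<close>

lemma findim_if_ker_image:
  assumes V: "subspace V" and f: "lin_on V f"
    and im: "findim (f ` V)" and ker: "findim {x \<in> V. f x = 0}"
  shows "findim V"
proof -
  obtain B where B: "finite B" "B \<subseteq> f ` V" "span B = f ` V"
    by (rule findim_basis[OF subspace_image_on[OF V f] im])
  obtain B' where B': "finite B'" "B' \<subseteq> V" "B = f ` B'"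
    using B finite_subset_image by metis
  obtain K where K: "finite K" "{x \<in> V. f x = 0} \<subseteq> span K"
    using ker by (auto simp: findim_def)
  have sB': "span B' \<subseteq> V" by (rule span_minimal[OF B'(2) V])
  have fB': "span (f ` B') \<subseteq> f ` span B'"
    by (rule span_minimal)
      (auto intro: span_base subspace_image_on lin_on_subset[OF f sB'])
  have "x \<in> span (B' \<union> K)" if x: "x \<in> V" for x
  proof -
    obtain y where y: "y \<in> span B'" "f x = f y"
      using x B(3) fB' B'(3) by blast
    have yV: "y \<in> V" using y sB' by blast
    have "x - y \<in> span K"
      using K(2) x yV y(2) lin_onD(5)[OF f V] subspace_diff[OF V] by auto
    then have "y + (x - y) \<in> span (B' \<union> K)"
      using y by (intro span_add) (auto intro: subsetD[OF span_mono])
    then show ?thesis by simp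
  qed
  then have "V \<subseteq> span (B' \<union> K)" by blast
  with K(1) B'(1) show ?thesis
    unfolding findim_def by (metis finite_Un)
qed

section \<open>Bounded operators between subspaces\<close>

text \<open>The notion \<^const>\<open>cbop\<close> with source and target allowed to have different types.\<close>

definition bop_on ::
  "('a::real_normed_vector \<Rightarrow> 'a) \<Rightarrow> 'a set \<Rightarrow> ('b::real_normed_vector \<Rightarrow> 'b) \<Rightarrow> 'b set \<Rightarrow> ('a \<Rightarrow> 'b) \<Rightarrow> bool"
  where "bop_on J X J' Y T \<longleftrightarrow> lin_on X T \<and> (\<forall>x\<in>X. T x \<in> Y) \<and> (\<forall>x\<in>X. T (J x) = J' (T x))
     \<and> (\<exists>K. \<forall>x\<in>X. norm (T x) \<le> K * norm x)"

lemma cbop_iff_bop_on: "cbop J X Y T \<longleftrightarrow> bop_on J X J Y T"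
  unfolding cbop_def bop_on_def lin_on_def by blast

lemma bop_on_lin: "bop_on J X J' Y T \<Longrightarrow> lin_on X T"
  and bop_on_in: "bop_on J X J' Y T \<Longrightarrow> x \<in> X \<Longrightarrow> T x \<in> Y"
  and bop_on_J: "bop_on J X J' Y T \<Longrightarrow> x \<in> X \<Longrightarrow> T (J x) = J' (T x)"
  by (auto simp: bop_on_def)

lemma bop_on_bound:
  assumes "bop_on J X J' Y T"
  obtains K where "K \<ge> 0" "\<And>x. x \<in> X \<Longrightarrow> norm (T x) \<le> K * norm x"
proof -
  obtain K where K: "\<And>x. x \<in> X \<Longrightarrow> norm (T x) \<le> K * norm x"
    using assms by (auto simp: bop_on_def)
  have "norm (T x) \<le> \<bar>K\<bar> * norm x" if "x \<in> X" for x
    using K[OF that] by (rule order_trans) (simp add: mult_right_mono)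
  with that[of "\<bar>K\<bar>"] show ?thesis by simp
qed

lemma cstructD:
  assumes "cstruct J"
  shows "bounded_linear J" "linear J" "J (J x) = - x"
  using assms by (auto simp: cstruct_def bounded_linear.linear)

lemma csubspaceD:
  assumes "csubspace J V"
  shows "subspace V" "x \<in> V \<Longrightarrow> J x \<in> V"
  using assms by (auto simp: csubspace_def)

lemma bop_on_mono:
  assumes "bop_on J X J' Y T" "X0 \<subseteq> X" "Y \<subseteq> Y0"
  shows "bop_on J X0 J' Y0 T"
  using assms unfolding bop_on_def lin_on_def by blast

lemma bop_on_id: "bop_on J X J X (\<lambda>x. x)"
  unfolding bop_on_def lin_on_def by (auto intro: exI[of _ 1])

lemma bop_on_comp:
  assumes S: "bop_on J' Y J'' Z S" and T: "bop_on J X J' Y T"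
  shows "bop_on J X J'' Z (\<lambda>x. S (T x))"
proof -
  obtain K where K: "K \<ge> 0" "\<And>x. x \<in> Y \<Longrightarrow> norm (S x) \<le> K * norm x"
    using bop_on_bound[OF S] by blast
  obtain L where L: "L \<ge> 0" "\<And>x. x \<in> X \<Longrightarrow> norm (T x) \<le> L * norm x"
    using bop_on_bound[OF T] by blast
  have "norm (S (T x)) \<le> (K * L) * norm x" if "x \<in> X" for x
  proof -
    have "norm (S (T x)) \<le> K * norm (T x)"
      using K(2) bop_on_in[OF T that] by simp
    also have "\<dots> \<le> K * (L * norm x)"
      using K(1) L(2)[OF that] by (rule mult_left_mono[rotated])
    finally show ?thesis by (simp add: mult.assoc)
  qed
  then have "\<exists>M. \<forall>x\<in>X. norm (S (T x)) \<le> M * norm x" by blast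
  then show ?thesis
    using S T unfolding bop_on_def lin_on_def by simp
qed

lemma bop_on_add:
  assumes S: "bop_on J X J' Y S" and T: "bop_on J X J' Y T" and J': "linear J'" and Y: "subspace Y"
  shows "bop_on J X J' Y (\<lambda>x. S x + T x)"
proof -
  obtain K where K: "K \<ge> 0" "\<And>x. x \<in> X \<Longrightarrow> norm (S x) \<le> K * norm x"
    using bop_on_bound[OF S] by blast
  obtain L where L: "L \<ge> 0" "\<And>x. x \<in> X \<Longrightarrow> norm (T x) \<le> L * norm x"
    using bop_on_bound[OF T] by blast
  have "norm (S x + T x) \<le> (K + L) * norm x" if "x \<in> X" for x
    using norm_triangle_ineq[of "S x" "T x"] K(2)[OF that] L(2)[OF that] by (simp add: algebra_simps)
  then have "\<exists>M. \<forall>x\<in>X. norm (S x + T x) \<le> M * norm x" by blast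
  then show ?thesis
    using S T unfolding bop_on_def lin_on_def
    by (simp add: linear_add[OF J'] subspace_add[OF Y] scaleR_add_right)
qed

lemma bop_on_uminus:
  assumes T: "bop_on J X J' Y T" and J': "linear J'" and Y: "subspace Y"
  shows "bop_on J X J' Y (\<lambda>x. - T x)"
  using T unfolding bop_on_def lin_on_def
  by (simp add: linear_neg[OF J'] subspace_neg[OF Y])

lemma bop_on_diff:
  assumes "bop_on J X J' Y S" "bop_on J X J' Y T" "linear J'" "subspace Y"
  shows "bop_on J X J' Y (\<lambda>x. S x - T x)"
  using bop_on_add[OF assms(1) bop_on_uminus[OF assms(2-4)] assms(3,4)] by simp

lemma bop_on_zero:
  assumes "linear J'" "subspace Y"
  shows "bop_on J X J' Y (\<lambda>x. 0)"
  using assms unfolding bop_on_def lin_on_def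
  by (auto simp: linear_0 subspace_0 intro: exI[of _ 0])

lemma bop_on_sum:
  assumes J': "linear J'" and Y: "subspace Y" and T: "\<And>i. i \<in> I \<Longrightarrow> bop_on J X J' Y (T i)"
  shows "bop_on J X J' Y (\<lambda>x. \<Sum>i\<in>I. T i x)"
  using T
proof (induction I rule: infinite_finite_induct)
  case (insert i I)
  then show ?case
    using bop_on_add[OF _ _ J' Y, of J X "T i" "\<lambda>x. \<Sum>i\<in>I. T i x"] by simp
qed (simp_all add: bop_on_zero[OF J' Y])

lemma closed_ker_on:
  assumes T: "bop_on J X J' Y T" and X: "subspace X" "closed X"
  shows "closed {x \<in> X. T x = 0}"
proof -
  obtain K where K: "K \<ge> 0" "\<And>x. x \<in> X \<Longrightarrow> norm (T x) \<le> K * norm x"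
    using bop_on_bound[OF T] by blast
  have "continuous_on X T"
  proof (rule continuous_onI)
    fix x e assume x: "x \<in> X" and e: "e > (0::real)"
    \<comment> \<open>Dividing by K + 1 rather than K keeps the radius positive when K = 0.\<close>
    have "dist (T y) (T x) \<le> e" if y: "y \<in> X" and d: "dist y x < e / (K + 1)" for y
    proof -
      have "dist (T y) (T x) \<le> K * dist y x"
        using K(2)[OF subspace_diff[OF X(1) y x]] lin_onD(5)[OF bop_on_lin[OF T] X(1) y x]
        by (simp add: dist_norm)
      also have "\<dots> \<le> (K + 1) * dist y x"
        by (simp add: mult_right_mono)
      also have "\<dots> \<le> e"
        using d K(1) by (simp add: field_simps)
      finally show ?thesis .
    qed
    moreover have "e / (K + 1) > 0" using e K(1) by simp
    ultimately show "\<exists>d>0. \<forall>x'\<in>X. dist x' x < d \<longrightarrow> dist (T x') (T x) \<le> e" by blast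
  qed
  then have "closed (X \<inter> T -` {0})"
    using X(2) by (intro continuous_closed_preimage) auto
  moreover have "X \<inter> T -` {0} = {x \<in> X. T x = 0}" by auto
  ultimately show ?thesis by simp
qed

lemma csubspace_ker_on:
  assumes T: "bop_on J X J' Y T" and X: "csubspace J X" and J': "linear J'"
  shows "csubspace J {x \<in> X. T x = 0}"
  using subspace_ker_on[OF csubspaceD(1)[OF X] bop_on_lin[OF T]] bop_on_J[OF T]
    csubspaceD(2)[OF X] linear_0[OF J']
  by (auto simp: csubspace_def)

lemma csubspace_image_on:
  assumes T: "bop_on J X J' Y T" and X: "csubspace J X"
  shows "csubspace J' (T ` X)"
proof -
  have "J' (T x) \<in> T ` X" if "x \<in> X" for x
    using bop_on_J[OF T that] csubspaceD(2)[OF X that] by (metis imageI)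
  then show ?thesis
    using subspace_image_on[OF csubspaceD(1)[OF X] bop_on_lin[OF T]]
    by (auto simp: csubspace_def)
qed

section \<open>Generalized inverses of finite rank operators\<close>

text \<open>Hahn-Banach enters here: Q is bounded on the whole target space although it inverts M
  only on a finite-dimensional part of the range. One vector is treated at a time, each corrected by
  a rank one term that does not disturb the earlier ones.\<close>

lemma right_inverse_on_span:
  fixes M :: "'a::real_normed_vector \<Rightarrow> 'b::real_normed_vector"
  assumes M: "bop_on J X J' Y M" and X: "subspace X" and B: "finite B" "B \<subseteq> M ` X"
  shows "\<exists>Q. bounded_linear Q \<and> range Q \<subseteq> X \<and> (\<forall>e\<in>span B. M (Q e) = e)"
  using B
proof (induction B rule: finite_induct)
  case empty
  then show ?case
    using subspace_0[OF X] lin_onD(3)[OF bop_on_lin[OF M] X]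
    by (intro exI[of _ "\<lambda>x. 0"]) auto
next
  case (insert b B)
  then obtain Q where Q: "bounded_linear Q" "range Q \<subseteq> X" "\<And>e. e \<in> span B \<Longrightarrow> M (Q e) = e"
    by auto
  note Ml = lin_onD[OF bop_on_lin[OF M] X]
  interpret Q: bounded_linear Q by (rule Q(1))
  have QX: "Q y \<in> X" for y using Q(2) by auto
  obtain K where K: "K \<ge> 0" "\<And>x. x \<in> X \<Longrightarrow> norm (M x) \<le> K * norm x"
    using bop_on_bound[OF M] by blast
  have MQ: "bounded_linear (\<lambda>y. M (Q y))"
  proof -
    obtain L where L: "\<And>x. norm (Q x) \<le> norm x * L"
      using Q.bounded by auto
    show ?thesis
    proof (rule bounded_linear_intro)
      show "M (Q (x + y)) = M (Q x) + M (Q y)" for x y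
        using QX by (simp add: Q.add Ml)
      show "M (Q (r *\<^sub>R x)) = r *\<^sub>R M (Q x)" for r x
        using QX by (simp add: Q.scale Ml)
      show "norm (M (Q x)) \<le> norm x * (L * K)" for x
        using order_trans[OF K(2)[OF QX] mult_left_mono[OF L K(1)]] by (simp add: mult_ac)
    qed
  qed
  obtain x0 where x0: "x0 \<in> X" "b = M x0"
    using insert.prems by auto
  define b' where "b' = b - M (Q b)"
  obtain g0 where g0: "bounded_linear g0" "g0 b' = norm b'"
    using norming_functional by blast
  \<comment> \<open>The functional is evaluated at y - M (Q y), which vanishes on the old span and
    equals \<open>b'\<close> at b, while M maps x0 - Q b to \<open>b'\<close>. If \<open>b'\<close>
    = 0, division by zero gives 0, and Q already inverts M at b.\<close>
  define Q' where "Q' y = Q y + (g0 (y - M (Q y)) / norm b') *\<^sub>R (x0 - Q b)" for y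
  have Q': "bounded_linear Q'"
    unfolding Q'_def
    by (intro bounded_linear_add Q(1) bounded_linear_compose[OF bounded_linear_scaleR_left]
        bounded_linear_compose[OF bounded_linear_divide] bounded_linear_compose[OF g0(1)]
        bounded_linear_sub bounded_linear_ident MQ)
  have Q'X: "Q' y \<in> X" for y
    using QX x0(1) X by (simp add: Q'_def subspace_add subspace_scale subspace_diff)
  have MQ': "M (Q' y) = M (Q y) + (g0 (y - M (Q y)) / norm b') *\<^sub>R b'" for y
    using QX x0 X by (simp add: Q'_def b'_def Ml subspace_scale subspace_diff)
  have "linear (\<lambda>y. M (Q' y))"
    using Q'X bounded_linear.linear[OF Q'] by (auto intro!: linearI simp: linear_add linear_scale Ml)
  then have "subspace {e. M (Q' e) = e}"
    by (simp add: subspace_def linear_add[of "\<lambda>y. M (Q' y)"] linear_scale[of "\<lambda>y. M (Q' y)"]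
        linear_0[of "\<lambda>y. M (Q' y)"])
  moreover have "insert b B \<subseteq> {e. M (Q' e) = e}"
    using Q(3) bounded_linear.linear[OF g0(1)] g0(2)
    by (auto simp: MQ' span_base linear_0) (simp add: b'_def)
  ultimately have "span (insert b B) \<subseteq> {e. M (Q' e) = e}"
    by (intro span_minimal)
  with Q' Q'X show ?case by (intro exI[of _ Q']) auto
qed

text \<open>Used twice: for the identity of a finite-dimensional space, where G is a projection, and
  for the defect T - T S T, where G repairs S.\<close>

lemma finite_rank_generalized_inverse:
  fixes M :: "'a::real_normed_vector \<Rightarrow> 'b::real_normed_vector"
  assumes J: "cstruct J" and J': "cstruct J'" and M: "bop_on J X J' Y M" and X: "csubspace J X"
    and fin: "findim (M ` X)"
  shows "\<exists>G. bop_on J' UNIV J X G \<and> (\<forall>x\<in>X. M (G (M x)) = M x)"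
proof -
  note sX = csubspaceD(1)[OF X]
  note Ml = lin_onD[OF bop_on_lin[OF M] sX]
  obtain B where B: "finite B" "B \<subseteq> M ` X" "span B = M ` X"
    by (rule findim_basis[OF subspace_image_on[OF sX bop_on_lin[OF M]] fin])
  obtain Q where Q: "bounded_linear Q" "range Q \<subseteq> X" "\<And>e. e \<in> M ` X \<Longrightarrow> M (Q e) = e"
    using right_inverse_on_span[OF M sX B(1,2)] B(3) by blast
  have QX: "Q y \<in> X" for y using Q(2) by auto
  \<comment> \<open>Averaging over the complex structure turns a real-linear inverse into a complex-linear one.\<close>
  define G where "G y = (1 / 2) *\<^sub>R (Q y - J (Q (J' y)))" for y
  have "bounded_linear G"
    unfolding G_def
    by (intro bounded_linear_compose[OF bounded_linear_scaleR_right] bounded_linear_sub Q(1)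
        bounded_linear_compose[OF cstructD(1)[OF J]] bounded_linear_compose[OF Q(1)] cstructD(1)[OF J'])
  then interpret G: bounded_linear G .
  have GX: "G y \<in> X" for y
    unfolding G_def using QX csubspaceD(2)[OF X] sX
    by (simp add: subspace_scale subspace_diff)
  have GJ: "G (J' y) = J (G y)" for y
    using cstructD(2,3)[OF J] cstructD(2,3)[OF J'] bounded_linear.linear[OF Q(1)]
    by (simp add: G_def linear_scale linear_diff linear_neg add.commute flip: scaleR_add_right)
  obtain K where "\<And>x. norm (G x) \<le> norm x * K"
    using G.bounded by auto
  then have "bop_on J' UNIV J X G"
    unfolding bop_on_def lin_on_def using GX GJ
    by (auto simp: G.add G.scale mult.commute intro!: exI[of _ K])
  moreover have "M (G (M x)) = M x" if "x \<in> X" for x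
  proof -
    have 1: "M (Q (M x)) = M x" using Q(3) that by simp
    have "J' (M x) \<in> M ` X"
      using bop_on_J[OF M that] csubspaceD(2)[OF X that] by (metis imageI)
    then have 2: "M (Q (J' (M x))) = J' (M x)" by (rule Q(3))
    have "M (G (M x)) = (1 / 2) *\<^sub>R (M (Q (M x)) - J' (M (Q (J' (M x)))))"
      unfolding G_def using QX csubspaceD[OF X] bop_on_J[OF M]
      by (simp add: Ml subspace_diff)
    also have "\<dots> = M x"
      unfolding 1 2 using cstructD(3)[OF J'] by (simp flip: scaleR_2)
    finally show ?thesis .
  qed
  ultimately show ?thesis by blast
qed

lemma findim_projection:
  assumes J: "cstruct J" and V: "csubspace J V" and fin: "findim V"
  shows "\<exists>P. bop_on J UNIV J V P \<and> (\<forall>v\<in>V. P v = v)"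
  using finite_rank_generalized_inverse[OF J J bop_on_id V] fin by simp

section \<open>The open mapping theorem\<close>

text \<open>The Baire half of the open mapping theorem. The closed range W is a complete metric
  space covered by the closures R n of images of balls, so some R n has interior points relative to
  W.\<close>

lemma approximate_preimage:
  fixes f :: "'a::real_normed_vector \<Rightarrow> 'b::banach"
  assumes V: "subspace V" and f: "lin_on V f" and cl: "closed (f ` V)"
  shows "\<exists>C\<ge>0. \<forall>w\<in>f ` V. \<exists>v\<in>V. norm v \<le> C * norm w \<and> norm (w - f v) \<le> norm w / 2"
proof -
  note fl = lin_onD[OF f V]
  define W where "W = f ` V"
  define R where "R n = closure (f ` (V \<inter> cball 0 (real n)))" for n
  have sW: "subspace W"
    unfolding W_def by (rule subspace_image_on[OF V f])
  have RW: "R n \<subseteq> W" for n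
    unfolding R_def W_def using cl by (intro closure_minimal) auto
  have "w \<in> (\<Union>n. R n)" if w: "w \<in> W" for w
  proof -
    obtain v where v: "v \<in> V" "w = f v" using w by (auto simp: W_def)
    obtain n where "norm v \<le> real n" using real_arch_simple by blast
    with v have "w \<in> R n"
      unfolding R_def by (intro subsetD[OF closure_subset]) auto
    then show ?thesis by blast
  qed
  with RW have UR: "(\<Union>n. R n) = W" by blast
  have "\<exists>n. top_of_set W interior_of R n \<noteq> {}"
  proof (rule ccontr)
    assume "\<not> ?thesis"
    moreover have "completely_metrizable_space (top_of_set W)"
      using cl completely_metrizable_space_closedin[OF completely_metrizable_space_euclidean]
      by (simp add: W_def)
    moreover have "closedin (top_of_set W) (R n)" for n
      using RW by (intro closed_subset) (auto simp: R_def)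
    ultimately have "top_of_set W interior_of \<Union>(range R) = {}"
      by (intro Baire_category_alt) auto
    then have "W = {}"
      unfolding UR using interior_of_topspace[of "top_of_set W"] by simp
    then show False using subspace_0[OF sW] by blast
  qed
  then obtain n U w0 where U: "openin (top_of_set W) U" "U \<subseteq> R n" "w0 \<in> U"
    unfolding interior_of_def by blast
  then obtain e where e: "e > 0" "ball w0 e \<inter> W \<subseteq> U"
    unfolding openin_contains_ball by blast
  have w0: "w0 \<in> R n" "w0 \<in> W" using U RW by blast+
  have near: "\<exists>v\<in>V. norm v \<le> real n \<and> dist (f v) z < d" if "z \<in> R n" "d > 0" for z d
    using that unfolding R_def closure_approachable by (fastforce simp: dist_norm)
  \<comment> \<open>Differences move the ball around w0 to the origin: approximate w0 + w and w0
    separately and subtract. This doubles the bound n and splits the error d in two.\<close>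
  have small: "\<exists>v\<in>V. norm v \<le> 2 * real n \<and> norm (w - f v) < d"
    if w: "w \<in> W" "norm w < e" and d: "d > 0" for w d
  proof -
    have "w0 + w \<in> ball w0 e \<inter> W"
      using w w0(2) subspace_add[OF sW] by (simp add: dist_norm)
    then have "w0 + w \<in> R n"
      using e(2) U(2) by blast
    then obtain v1 where v1: "v1 \<in> V" "norm v1 \<le> real n" "dist (f v1) (w0 + w) < d / 2"
      using near half_gt_zero[OF d] by blast
    obtain v2 where v2: "v2 \<in> V" "norm v2 \<le> real n" "dist (f v2) w0 < d / 2"
      using near[OF w0(1) half_gt_zero[OF d]] by blast
    have "norm (v1 - v2) \<le> 2 * real n"
      using norm_triangle_ineq4[of v1 v2] v1(2) v2(2) by simp
    moreover have "norm (w - f (v1 - v2)) < d"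
    proof -
      have "w - f (v1 - v2) = (f v2 - w0) - (f v1 - (w0 + w))"
        using v1 v2 by (simp add: fl)
      also have "norm \<dots> \<le> norm (f v2 - w0) + norm (f v1 - (w0 + w))"
        by (rule norm_triangle_ineq4)
      also have "\<dots> < d"
        using v1(3) v2(3) by (simp add: dist_norm)
      finally show ?thesis .
    qed
    ultimately show ?thesis
      using v1(1) v2(1) subspace_diff[OF V] by blast
  qed
  have "\<exists>v\<in>V. norm v \<le> (4 * real n / e) * norm w \<and> norm (w - f v) \<le> norm w / 2" if w: "w \<in> W" for w
  proof (cases "w = 0")
    case True
    then show ?thesis
      using subspace_0[OF V] fl(3) by (intro bexI[of _ 0]) auto
  next
    case False
    \<comment> \<open>Scaling w to norm e/2 puts it inside the ball, and accuracy e/4 is then half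
      its norm. Undoing the scaling turns the bound 2n into 4n/e times norm w.\<close>
    define t where "t = e / (2 * norm w)"
    have t: "t > 0" using e False by (simp add: t_def)
    have ntw: "norm (t *\<^sub>R w) = e / 2"
      using e False by (simp add: t_def)
    obtain v where v: "v \<in> V" "norm v \<le> 2 * real n" "norm (t *\<^sub>R w - f v) < e / 4"
      using small[of "t *\<^sub>R w" "e / 4"] e(1) ntw subspace_scale[OF sW w] by auto
    have "norm ((1 / t) *\<^sub>R v) = norm v / t"
      using t by simp
    also have "\<dots> \<le> 2 * real n / t"
      using v(2) t by (intro divide_right_mono) auto
    also have "\<dots> = (4 * real n / e) * norm w"
      using e False by (simp add: t_def field_simps)
    finally have 1: "norm ((1 / t) *\<^sub>R v) \<le> (4 * real n / e) * norm w" .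
    have "w - f ((1 / t) *\<^sub>R v) = (1 / t) *\<^sub>R (t *\<^sub>R w - f v)"
      using t v(1) by (simp add: fl scaleR_diff_right)
    then have "norm (w - f ((1 / t) *\<^sub>R v)) = norm (t *\<^sub>R w - f v) / t"
      using t by simp
    also have "\<dots> \<le> (e / 4) / t"
      using v(3) t by (intro divide_right_mono) auto
    also have "\<dots> = norm w / 2"
      using e False by (simp add: t_def field_simps)
    finally show ?thesis
      using 1 subspace_scale[OF V v(1)] by blast
  qed
  moreover have "4 * real n / e \<ge> 0" using e by simp
  ultimately show ?thesis unfolding W_def by blast
qed

text \<open>Successive approximation: corrections that halve the error form a geometric series with
  sum in the closed space V. It gives an exact preimage of f v of norm at most 2C norm (f v), and
  injectivity identifies this preimage with v.\<close>

lemma bounded_below_if_closed_range: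
  fixes f :: "'a::banach \<Rightarrow> 'b::banach"
  assumes f: "bop_on J V J' Y f" and V: "subspace V" "closed V" and cl: "closed (f ` V)"
    and inj: "\<And>v. v \<in> V \<Longrightarrow> f v = 0 \<Longrightarrow> v = 0"
  shows "\<exists>C\<ge>0. \<forall>v\<in>V. norm v \<le> C * norm (f v)"
proof -
  note fl = lin_onD[OF bop_on_lin[OF f] V(1)]
  obtain K where K: "K \<ge> 0" "\<And>x. x \<in> V \<Longrightarrow> norm (f x) \<le> K * norm x"
    using bop_on_bound[OF f] by blast
  have sW: "subspace (f ` V)"
    by (rule subspace_image_on[OF V(1) bop_on_lin[OF f]])
  obtain C g where C: "C \<ge> 0" and g: "\<And>w. w \<in> f ` V \<Longrightarrow> g w \<in> V"
    "\<And>w. w \<in> f ` V \<Longrightarrow> norm (g w) \<le> C * norm w"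
    "\<And>w. w \<in> f ` V \<Longrightarrow> norm (w - f (g w)) \<le> norm w / 2"
    using approximate_preimage[OF V(1) bop_on_lin[OF f] cl] by metis
  have "norm v \<le> (2 * C) * norm (f v)" if v: "v \<in> V" for v
  proof -
    define w where "w = f v"
    \<comment> \<open>The error left after k corrections: the partial sums of g (r k) are mapped to
      w - r N.\<close>
    define r where "r k = ((\<lambda>u. u - f (g u)) ^^ k) w" for k
    have r0: "r 0 = w" and rS: "r (Suc k) = r k - f (g (r k))" for k
      by (simp_all add: r_def)
    have rW: "r k \<in> f ` V" for k
    proof (induction k)
      case 0
      then show ?case using v by (simp add: r0 w_def)
    next
      case (Suc k)
      then show ?case unfolding rS using g(1) by (intro subspace_diff[OF sW]) auto
    qed
    have rn: "norm (r k) \<le> norm w * (1 / 2) ^ k" for k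
    proof (induction k)
      case (Suc k)
      then show ?case using g(3)[OF rW[of k]] by (simp add: rS)
    qed (simp add: r0)
    define x where "x k = g (r k)" for k
    have xV: "x k \<in> V" for k using g(1)[OF rW] by (simp add: x_def)
    have xn: "norm (x k) \<le> C * norm w * (1 / 2) ^ k" for k
      using order_trans[OF g(2)[OF rW[of k]] mult_left_mono[OF rn[of k] C]]
      by (simp add: x_def mult.assoc)
    have sg: "(\<lambda>k. C * norm w * (1 / 2) ^ k) sums (C * norm w * 2)"
      using geometric_sums[of "1 / 2 :: real"] by (intro sums_mult) auto
    have sn: "summable (\<lambda>k. norm (x k))"
      by (rule summable_comparison_test'[OF sums_summable[OF sg], of 0]) (use xn in auto)
    define s where "s = suminf x"
    have lim: "(\<lambda>N. \<Sum>k<N. x k) \<longlonglongrightarrow> s"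
      using summable_LIMSEQ[OF summable_norm_cancel[OF sn]] by (simp add: s_def)
    have pV: "(\<Sum>k<N. x k) \<in> V" for N
      using xV by (intro subspace_sum[OF V(1)])
    have sV: "s \<in> V"
      using closed_sequentially[OF V(2) pV lim] .
    have "norm s \<le> (\<Sum>k. norm (x k))"
      unfolding s_def by (rule summable_norm[OF sn])
    also have "\<dots> \<le> C * norm w * 2"
      using suminf_le[OF xn sn sums_summable[OF sg]] sums_unique[OF sg] by simp
    finally have sbound: "norm s \<le> C * norm w * 2" .
    have fp: "f (\<Sum>k<N. x k) = w - r N" for N
      using xV pV by (induction N) (simp_all add: r0 rS fl x_def)
    have "(\<lambda>N. r N) \<longlonglongrightarrow> 0"
    proof (rule Lim_null_comparison)
      show "\<forall>\<^sub>F N in sequentially. norm (r N) \<le> norm w * (1 / 2) ^ N" using rn by simp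
      show "(\<lambda>N. norm w * (1 / 2) ^ N) \<longlonglongrightarrow> 0"
        by (intro tendsto_mult_right_zero LIMSEQ_realpow_zero) auto
    qed
    then have "(\<lambda>N. f (\<Sum>k<N. x k)) \<longlonglongrightarrow> w"
      unfolding fp using tendsto_diff[OF tendsto_const, of r 0 sequentially w] by simp
    moreover have "(\<lambda>N. f (\<Sum>k<N. x k)) \<longlonglongrightarrow> f s"
    proof (rule LIM_zero_cancel, rule Lim_null_comparison)
      show "\<forall>\<^sub>F N in sequentially. norm (f (\<Sum>k<N. x k) - f s) \<le> K * norm ((\<Sum>k<N. x k) - s)"
        using K(2) pV sV subspace_diff[OF V(1)] by (simp flip: fl(5))
      show "(\<lambda>N. K * norm ((\<Sum>k<N. x k) - s)) \<longlonglongrightarrow> 0"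
        using tendsto_norm[OF LIM_zero[OF lim]] by (intro tendsto_mult_right_zero) simp
    qed
    ultimately have "f s = w" by (rule LIMSEQ_unique[symmetric])
    then have "v - s = 0"
      using v sV by (intro inj) (auto simp: fl w_def subspace_diff[OF V(1)])
    then show ?thesis using sbound by (simp add: w_def mult_ac)
  qed
  then show ?thesis using C by (intro exI[of _ "2 * C"]) auto
qed

section \<open>Left Fredholm operators and left inverses modulo finite rank\<close>

text \<open>The remainder is of finite rank rather than merely compact, so it passes through sums
  and linear images by counting dimensions alone.\<close>

definition left_regular ::
  "('a::real_normed_vector \<Rightarrow> 'a) \<Rightarrow> 'a set \<Rightarrow> 'a set \<Rightarrow> ('a \<Rightarrow> 'a) \<Rightarrow> bool" where
  "left_regular J X Y T \<longleftrightarrow> (\<exists>S. bop_on J Y J X S \<and> findim ((\<lambda>x. x - S (T x)) ` X))"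

lemma cdim_finite_iff: "cdim V < \<infinity> \<longleftrightarrow> findim V"
  by (simp add: cdim_def findim_def)

lemma alpha_finite_iff: "alpha X T < \<infinity> \<longleftrightarrow> findim {x \<in> X. T x = 0}"
  unfolding alpha_def kerOp_def by (rule cdim_finite_iff)

text \<open>Split X into the kernel K and the kernel X0 of a projection P onto K, and Y into the
  range and N. Then (x, n) \<mapsto> T x + n is a bounded bijection from X0 \<times> N onto Y. S is
  the first component of its inverse, and S T = I - P.\<close>

lemma left_fredholm_imp_left_regular:
  fixes J :: "'a::banach \<Rightarrow> 'a"
  assumes J: "cstruct J" and X: "csubspace J X" "closed X" and Y: "csubspace J Y" "closed Y"
    and T: "bop_on J X J Y T" and lf: "left_fredholm J X Y T"
  shows "left_regular J X Y T"
proof -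
  note sX = csubspaceD(1)[OF X(1)] and sY = csubspaceD(1)[OF Y(1)] and lJ = cstructD(2)[OF J]
  note Tl = lin_onD[OF bop_on_lin[OF T] sX]
  define K where "K = {x \<in> X. T x = 0}"
  have K: "csubspace J K" "findim K"
    using csubspace_ker_on[OF T X(1) lJ] lf alpha_finite_iff[of X T]
    by (auto simp: K_def left_fredholm_def)
  obtain P where P: "bop_on J UNIV J K P" "\<And>v. v \<in> K \<Longrightarrow> P v = v"
    using findim_projection[OF J K] by blast
  have PK: "P x \<in> K" for x using bop_on_in[OF P(1)] by simp
  note Pl = lin_onD[OF bop_on_lin[OF P(1)] subspace_UNIV, simplified]
  have PX: "bop_on J X J K P" by (rule bop_on_mono[OF P(1)]) auto
  define X0 where "X0 = {x \<in> X. P x = 0}"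
  have X0: "csubspace J X0" "closed X0"
    unfolding X0_def by (rule csubspace_ker_on[OF PX X(1) lJ], rule closed_ker_on[OF PX sX X(2)])
  note sX0 = csubspaceD(1)[OF X0(1)]
  obtain N where N: "csubspace J N" "closed N" "N \<subseteq> Y" "T ` X \<inter> N = {0}"
    "\<forall>y\<in>Y. \<exists>m\<in>T ` X. \<exists>c\<in>N. y = m + c"
    using lf unfolding left_fredholm_def complemented_def by (elim conjE exE) (rule that)
  note sN = csubspaceD(1)[OF N(1)]
  have X0X: "X0 \<subseteq> X" by (auto simp: X0_def)
  \<comment> \<open>S y is the only x in X0 with y - T x in N. Additivity, homogeneity,
    compatibility with J and the value of S (T x) all follow by checking this property.\<close>
  have unique: "x = x'" if "x \<in> X0" "x' \<in> X0" "y - T x \<in> N" "y - T x' \<in> N" for x x' y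
  proof -
    have d: "x - x' \<in> X0" using that sX0 by (simp add: subspace_diff)
    have "T (x - x') = (y - T x') - (y - T x)"
      using that X0X by (simp add: Tl subset_iff)
    then have "T (x - x') \<in> N" using that sN by (metis subspace_diff)
    moreover have "T (x - x') \<in> T ` X" using d X0X by blast
    ultimately have "T (x - x') = 0" using N(4) by blast
    then have "x - x' \<in> K" using d by (auto simp: K_def X0_def)
    then have "P (x - x') = x - x'" by (rule P(2))
    then show ?thesis using d by (simp add: X0_def)
  qed
  have "\<exists>x\<in>X0. y - T x \<in> N" if y: "y \<in> Y" for y
  proof -
    obtain x c where x: "x \<in> X" "c \<in> N" "y = T x + c" using bspec[OF N(5) y] by blast
    have Px: "P x \<in> X" "T (P x) = 0" "P (P x) = P x"
      using PK[of x] P(2)[OF PK[of x]] by (auto simp: K_def)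
    then have "x - P x \<in> X0"
      using x(1) sX by (simp add: X0_def subspace_diff Pl)
    moreover have "y - T (x - P x) = c"
      using x Px by (simp add: Tl)
    ultimately show ?thesis using x(2) by metis
  qed
  then obtain S where S: "\<And>y. y \<in> Y \<Longrightarrow> S y \<in> X0" "\<And>y. y \<in> Y \<Longrightarrow> y - T (S y) \<in> N"
    by metis
  \<comment> \<open>The open mapping theorem is applied on the product, since T on X0 alone would
    say nothing about the N-component of y.\<close>
  define \<Phi> where "\<Phi> = (\<lambda>(x, n). T x + n)"
  have V: "subspace (X0 \<times> N)" "closed (X0 \<times> N)"
    using sX0 sN X0(2) N(2) by (auto intro: subspace_Times closed_Times)
  have \<Phi>: "bop_on (map_prod J J) (X0 \<times> N) J Y \<Phi>"
  proof -
    obtain L where L: "L \<ge> 0" "\<And>x. x \<in> X \<Longrightarrow> norm (T x) \<le> L * norm x"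
      using bop_on_bound[OF T] by blast
    have "norm (\<Phi> z) \<le> (L + 1) * norm z" if "z \<in> X0 \<times> N" for z
    proof -
      have "norm (\<Phi> z) \<le> norm (T (fst z)) + norm (snd z)"
        by (simp add: \<Phi>_def case_prod_unfold norm_triangle_ineq)
      also have "\<dots> \<le> L * norm z + norm z"
        using L that X0X norm_fst_le[of "fst z" "snd z"] norm_snd_le[of "snd z" "fst z"]
        by (intro add_mono order_trans[OF L(2) mult_left_mono]) auto
      finally show ?thesis by (simp add: algebra_simps)
    qed
    moreover have "lin_on (X0 \<times> N) \<Phi>"
      using X0X by (auto simp: lin_on_def \<Phi>_def Tl subset_iff scaleR_add_right)
    moreover have "\<Phi> z \<in> Y" "\<Phi> (map_prod J J z) = J (\<Phi> z)" if "z \<in> X0 \<times> N" for z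
      using that X0X N(3) sY bop_on_in[OF T] bop_on_J[OF T] linear_add[OF lJ]
      by (auto simp: \<Phi>_def subset_iff subspace_add)
    ultimately show ?thesis unfolding bop_on_def by blast
  qed
  have "\<Phi> ` (X0 \<times> N) = Y"
  proof
    show "\<Phi> ` (X0 \<times> N) \<subseteq> Y" using bop_on_in[OF \<Phi>] by blast
    show "Y \<subseteq> \<Phi> ` (X0 \<times> N)"
    proof
      fix y assume "y \<in> Y"
      then show "y \<in> \<Phi> ` (X0 \<times> N)"
        using S by (intro image_eqI[where x = "(S y, y - T (S y))"]) (auto simp: \<Phi>_def)
    qed
  qed
  moreover have "z = 0" if "z \<in> X0 \<times> N" "\<Phi> z = 0" for z
  proof -
    have z: "fst z \<in> X0" "snd z \<in> N" "T (fst z) = - snd z"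
      using that by (auto simp: \<Phi>_def case_prod_unfold eq_neg_iff_add_eq_0)
    have "fst z = 0"
      using z subspace_0[OF sX0] subspace_0[OF sN] by (intro unique[of _ _ 0]) (auto simp: Tl)
    then show ?thesis using z(3) by (simp add: Tl prod_eq_iff)
  qed
  ultimately obtain c where c: "c \<ge> 0" "\<And>z. z \<in> X0 \<times> N \<Longrightarrow> norm z \<le> c * norm (\<Phi> z)"
    using bounded_below_if_closed_range[OF \<Phi> V] Y(2) by metis
  have "norm (S y) \<le> c * norm y" if "y \<in> Y" for y
    using c(2)[of "(S y, y - T (S y))"] S[OF that] norm_fst_le[of "S y" "y - T (S y)"]
    by (auto simp: \<Phi>_def)
  moreover have "S (x + y) = S x + S y" if "x \<in> Y" "y \<in> Y" for x y
  proof (rule unique)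
    show "S (x + y) \<in> X0" "S x + S y \<in> X0" "(x + y) - T (S (x + y)) \<in> N"
      using S that sX0 sY by (simp_all add: subspace_add)
    have "(x + y) - T (S x + S y) = (x - T (S x)) + (y - T (S y))"
      using S(1) that X0X by (simp add: Tl subset_iff)
    then show "(x + y) - T (S x + S y) \<in> N"
      using subspace_add[OF sN S(2) S(2)] that by metis
  qed
  moreover have "S (r *\<^sub>R x) = r *\<^sub>R S x" if "x \<in> Y" for r x
  proof (rule unique)
    show "S (r *\<^sub>R x) \<in> X0" "r *\<^sub>R S x \<in> X0" "r *\<^sub>R x - T (S (r *\<^sub>R x)) \<in> N"
      using S that sX0 sY by (simp_all add: subspace_scale)
    have "r *\<^sub>R x - T (r *\<^sub>R S x) = r *\<^sub>R (x - T (S x))"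
      using S(1) that X0X by (simp add: Tl subset_iff scaleR_diff_right)
    then show "r *\<^sub>R x - T (r *\<^sub>R S x) \<in> N"
      using S(2) that sN by (simp add: subspace_scale)
  qed
  moreover have "S (J x) = J (S x)" if "x \<in> Y" for x
  proof (rule unique)
    show "S (J x) \<in> X0" "J (S x) \<in> X0" "J x - T (S (J x)) \<in> N"
      using S that csubspaceD(2)[OF X0(1)] csubspaceD(2)[OF Y(1)] by simp_all
    have "J x - T (J (S x)) = J (x - T (S x))"
      using S(1) that X0X bop_on_J[OF T] by (simp add: linear_diff[OF lJ] subset_iff)
    then show "J x - T (J (S x)) \<in> N"
      using S(2) that csubspaceD(2)[OF N(1)] by simp
  qed
  ultimately have "bop_on J Y J X S"
    using S(1) X0X unfolding bop_on_def lin_on_def by blast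
  moreover have "x - S (T x) \<in> K" if "x \<in> X" for x
  proof -
    have Px: "P x \<in> X" "T (P x) = 0" "P (P x) = P x"
      using PK[of x] P(2)[OF PK[of x]] by (auto simp: K_def)
    have TY: "T x \<in> Y" using bop_on_in[OF T that] .
    have "S (T x) = x - P x"
      using S TY that Px sX subspace_0[OF sN]
      by (intro unique[of _ _ "T x"]) (auto simp: X0_def subspace_diff Pl Tl)
    then show ?thesis using PK by simp
  qed
  then have "findim ((\<lambda>x. x - S (T x)) ` X)"
    by (intro findim_subset[OF K(2)]) auto
  ultimately show ?thesis unfolding left_regular_def by blast
qed

text \<open>If \<open>T S T - T\<close> has finite rank then correcting \<open>S\<close> by
  \<open>(I - S T) G (I - T S)\<close>, with \<open>G\<close> a generalized inverse of \<open>T - T S T\<close>,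
  makes it a generalized inverse of \<open>T\<close>.\<close>

lemma left_regular_generalized_inverse:
  fixes J :: "'a::real_normed_vector \<Rightarrow> 'a"
  assumes J: "cstruct J" and X: "csubspace J X" and Y: "csubspace J Y"
    and T: "bop_on J X J Y T" and reg: "left_regular J X Y T"
  obtains S where "bop_on J Y J X S" "\<And>x. x \<in> X \<Longrightarrow> T (S (T x)) = T x"
proof -
  note sX = csubspaceD(1)[OF X] and sY = csubspaceD(1)[OF Y] and lJ = cstructD(2)[OF J]
  note Tl = lin_onD[OF bop_on_lin[OF T] sX]
  obtain S where S: "bop_on J Y J X S" "findim ((\<lambda>x. x - S (T x)) ` X)"
    using reg by (auto simp: left_regular_def)
  note SX = bop_on_in[OF S(1)] and TY = bop_on_in[OF T]
  have ST: "bop_on J X J X (\<lambda>x. x - S (T x))"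
    by (rule bop_on_diff[OF bop_on_id bop_on_comp[OF S(1) T] lJ sX])
  define M where "M x = T (x - S (T x))" for x
  have M: "bop_on J X J Y M"
    unfolding M_def by (rule bop_on_comp[OF T ST])
  have "findim (T ` (\<lambda>x. x - S (T x)) ` X)"
    using bop_on_in[OF ST]
    by (intro findim_image subspace_image_on[OF sX] bop_on_lin[OF ST] S(2)
        lin_on_subset[OF bop_on_lin[OF T]]) auto
  then have "findim (M ` X)"
    by (simp add: M_def image_image)
  then obtain G where G: "bop_on J UNIV J X G" "\<And>x. x \<in> X \<Longrightarrow> M (G (M x)) = M x"
    using finite_rank_generalized_inverse[OF J J M X] by blast
  have GY: "bop_on J Y J X G" by (rule bop_on_mono[OF G(1)]) auto
  have GX: "G y \<in> X" for y using bop_on_in[OF G(1)] by simp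
  define w where "w y = G (y - T (S y))" for y
  have w: "bop_on J Y J X w"
    unfolding w_def by (rule bop_on_comp[OF GY bop_on_diff[OF bop_on_id bop_on_comp[OF T S(1)] lJ sY]])
  define S' where "S' y = S y + (w y - S (T (w y)))" for y
  have "bop_on J Y J X S'"
    unfolding S'_def by (rule bop_on_add[OF S(1) bop_on_comp[OF ST w] lJ sX])
  moreover have "T (S' (T x)) = T x" if x: "x \<in> X" for x
  proof -
    \<comment> \<open>M is both T (I - S T) and (I - T S) T, so the correction contributes M G M x =
      M x, exactly the missing T x - T S T x.\<close>
    have "w (T x) = G (M x)"
      using x by (simp add: w_def M_def Tl SX TY)
    then have "T (w (T x) - S (T (w (T x)))) = M x"
      using G(2)[OF x] by (simp add: M_def)
    then have "T (S' (T x)) = T (S (T x)) + M x"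
      unfolding S'_def using x bop_on_in[OF ST] bop_on_in[OF w] by (simp add: Tl(1) SX TY)
    also have "\<dots> = T x"
      using x by (simp add: M_def Tl SX TY)
    finally show ?thesis .
  qed
  ultimately show ?thesis using that by blast
qed

text \<open>The kernel lies in the range of I - R T, since x = x - R (T x) there. With T S T = T the
  operator Q = T S is a bounded projection onto the range, so the range is the kernel of I - Q and
  the kernel of Q complements it.\<close>

lemma left_regular_imp_left_fredholm:
  fixes J :: "'a::real_normed_vector \<Rightarrow> 'a"
  assumes J: "cstruct J" and X: "csubspace J X" and Y: "csubspace J Y" "closed Y"
    and T: "bop_on J X J Y T" and reg: "left_regular J X Y T"
  shows "left_fredholm J X Y T"
proof -
  note sX = csubspaceD(1)[OF X] and sY = csubspaceD(1)[OF Y(1)] and lJ = cstructD(2)[OF J]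
  obtain R where R: "bop_on J Y J X R" "findim ((\<lambda>x. x - R (T x)) ` X)"
    using reg by (auto simp: left_regular_def)
  have "{x \<in> X. T x = 0} \<subseteq> (\<lambda>x. x - R (T x)) ` X"
    using lin_onD(3)[OF bop_on_lin[OF R(1)] sY] by (auto intro!: image_eqI)
  then have alpha: "alpha X T < \<infinity>"
    unfolding alpha_finite_iff by (rule findim_subset[OF R(2)])
  obtain S where S: "bop_on J Y J X S" "\<And>x. x \<in> X \<Longrightarrow> T (S (T x)) = T x"
    using left_regular_generalized_inverse[OF J X Y(1) T reg] by blast
  note SX = bop_on_in[OF S(1)] and TY = bop_on_in[OF T]
  define Q where "Q y = T (S y)" for y
  have Q: "bop_on J Y J Y Q"
    unfolding Q_def by (rule bop_on_comp[OF T S(1)])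
  have IQ: "bop_on J Y J Y (\<lambda>y. y - Q y)"
    by (rule bop_on_diff[OF bop_on_id Q lJ sY])
  have QT: "Q y \<in> T ` X" if "y \<in> Y" for y
    using SX that by (auto simp: Q_def)
  have QQ: "Q y = y" if "y \<in> T ` X" for y
    using that S(2) by (auto simp: Q_def)
  have TX: "T ` X = {y \<in> Y. y - Q y = 0}"
  proof
    show "T ` X \<subseteq> {y \<in> Y. y - Q y = 0}" using QQ TY by auto
    show "{y \<in> Y. y - Q y = 0} \<subseteq> T ` X"
      using QT by clarsimp metis
  qed
  have cl: "closed (T ` X)"
    unfolding TX by (rule closed_ker_on[OF IQ sY Y(2)])
  define N where "N = {y \<in> Y. Q y = 0}"
  have N: "csubspace J N" "closed N"
    unfolding N_def by (rule csubspace_ker_on[OF Q Y(1) lJ], rule closed_ker_on[OF Q sY Y(2)])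
  have "T ` X \<inter> N = {0}"
  proof
    show "T ` X \<inter> N \<subseteq> {0}" using QQ by (force simp: N_def)
    show "{0} \<subseteq> T ` X \<inter> N"
      using subspace_0[OF csubspaceD(1)[OF N(1)]] subspace_0[OF subspace_image_on[OF sX bop_on_lin[OF T]]]
      by simp
  qed
  moreover have "\<exists>m\<in>T ` X. \<exists>c\<in>N. y = m + c" if "y \<in> Y" for y
  proof (intro bexI)
    show "y = Q y + (y - Q y)" by simp
    show "Q y \<in> T ` X" by (rule QT[OF that])
    show "y - Q y \<in> N"
      using that bop_on_in[OF Q] QQ[OF QT] lin_onD(5)[OF bop_on_lin[OF Q] sY]
      by (simp add: N_def subspace_diff[OF sY])
  qed
  ultimately have "complemented J Y (T ` X)"
    unfolding complemented_def using N cl csubspace_image_on[OF T X] TY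
    by (intro conjI exI[of _ N]) (auto simp: N_def)
  then show ?thesis
    using alpha cl by (simp add: left_fredholm_def)
qed

lemma left_fredholm_iff_left_regular:
  fixes J :: "'a::banach \<Rightarrow> 'a"
  assumes "cstruct J" "csubspace J X" "closed X" "csubspace J Y" "closed Y" "bop_on J X J Y T"
  shows "left_fredholm J X Y T \<longleftrightarrow> left_regular J X Y T"
  using left_fredholm_imp_left_regular[OF assms] left_regular_imp_left_fredholm[OF assms(1,2,4-6)]
  by blast

section \<open>Direct sums and triangular operators\<close>

lemma linear_vecJ: "linear J \<Longrightarrow> linear (vecJ J)"
  by (auto intro!: linearI simp: vecJ_def vec_eq_iff linear_add linear_scale)

lemma norm_component_le:
  fixes x :: "'a::real_normed_vector ^ 'n::finite"
  shows "norm (x $ i) \<le> norm x"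
  unfolding norm_vec_def by (rule member_le_L2_set) auto

lemma norm_vec_lambda_le: "norm (\<chi> i. f i) \<le> (\<Sum>i\<in>UNIV. norm (f i))"
  unfolding norm_vec_def by (simp add: L2_set_le_sum)

lemma bop_on_vec_lambda:
  fixes f :: "'n::finite \<Rightarrow> 'a::real_normed_vector \<Rightarrow> 'b::real_normed_vector"
  assumes f: "\<And>i. bop_on J' Z J (X i) (f i)"
  shows "bop_on J' Z (vecJ J) (dirsum X) (\<lambda>z. \<chi> i. f i z)"
proof -
  have "\<exists>K. \<forall>z\<in>Z. norm (f i z) \<le> K * norm z" for i
    using f by (simp add: bop_on_def)
  then obtain K where K: "\<And>i z. z \<in> Z \<Longrightarrow> norm (f i z) \<le> K i * norm z"
    by metis
  have "norm (\<chi> i. f i z) \<le> (\<Sum>i\<in>UNIV. K i) * norm z" if "z \<in> Z" for z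
    unfolding sum_distrib_right
    using that K by (intro order_trans[OF norm_vec_lambda_le] sum_mono)
  then have "\<exists>K. \<forall>z\<in>Z. norm (\<chi> i. f i z) \<le> K * norm z" by blast
  then show ?thesis
    using f unfolding bop_on_def lin_on_def by (simp add: dirsum_def vecJ_def vec_eq_iff)
qed

lemma cstruct_vecJ:
  fixes J :: "'a::real_normed_vector \<Rightarrow> 'a"
  assumes J: "cstruct J"
  shows "cstruct (vecJ J :: 'a ^ 'n::finite \<Rightarrow> 'a ^ 'n)"
proof -
  obtain K where K: "\<And>x. norm (J x) \<le> norm x * K"
    using bounded_linear.bounded[OF cstructD(1)[OF J]] by auto
  have "K * norm (x $ i) \<le> \<bar>K\<bar> * norm x" for x :: "'a ^ 'n" and i
    by (intro mult_mono) (auto simp: norm_component_le)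
  then have "norm (J (x $ i)) \<le> \<bar>K\<bar> * norm x" for x :: "'a ^ 'n" and i
    using K[of "x $ i"] by (metis mult.commute order_trans)
  then have "norm (vecJ J x) \<le> norm x * (of_nat CARD('n) * \<bar>K\<bar>)" for x :: "'a ^ 'n"
    unfolding vecJ_def
    by (intro order_trans[OF norm_vec_lambda_le] order_trans[OF sum_bounded_above[where K = "\<bar>K\<bar> * norm x"]])
      (auto simp: mult_ac)
  moreover have "linear (vecJ J :: 'a ^ 'n \<Rightarrow> 'a ^ 'n)"
    by (rule linear_vecJ[OF cstructD(2)[OF J]])
  ultimately have "bounded_linear (vecJ J :: 'a ^ 'n \<Rightarrow> 'a ^ 'n)"
    by (intro bounded_linear_intro) (auto simp: linear_add linear_scale)
  then show ?thesis
    using cstructD(3)[OF J] by (simp add: cstruct_def vecJ_def vec_eq_iff)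
qed

lemma csubspace_dirsum:
  fixes X :: "'n::finite \<Rightarrow> 'a::real_normed_vector set"
  assumes "\<And>i. csubspace J (X i)"
  shows "csubspace (vecJ J) (dirsum X)"
  using assms by (auto simp: csubspace_def dirsum_def vecJ_def subspace_def)

lemma closed_dirsum:
  fixes X :: "'n::finite \<Rightarrow> 'a::real_normed_vector set"
  assumes "\<And>i. closed (X i)"
  shows "closed (dirsum X)"
  unfolding dirsum_def using assms by (intro closed_vector_box) auto

lemma findim_dirsum:
  fixes E :: "'n::finite \<Rightarrow> 'a::real_normed_vector set"
  assumes "\<And>i. findim (E i)"
  shows "findim (dirsum E)"
proof -
  obtain B where B: "\<And>i. finite (B i)" "\<And>i. E i \<subseteq> span (B i)"
    using assms unfolding findim_def by metis
  let ?B = "\<Union>i. axis i ` B i"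
  have "x \<in> span ?B" if x: "x \<in> dirsum E" for x
  proof -
    have "axis i (x $ i) \<in> span ?B" for i
    proof -
      have lin: "linear (axis i :: 'a \<Rightarrow> 'a ^ 'n)"
        by (auto intro!: linearI simp: axis_def vec_eq_iff)
      have "x $ i \<in> span (B i)" using x B(2) by (auto simp: dirsum_def)
      then have "axis i (x $ i) \<in> span (axis i ` B i)"
        by (simp add: linear_span_image[OF lin])
      then show ?thesis by (rule subsetD[OF span_mono, rotated]) auto
    qed
    then have "(\<Sum>i\<in>UNIV. axis i (x $ i)) \<in> span ?B"
      by (intro span_sum)
    moreover have "(\<Sum>i\<in>UNIV. axis i (x $ i)) = x"
      by (simp add: vec_eq_iff axis_def)
    ultimately show ?thesis by simp
  qed
  moreover have "finite ?B" using B(1) by simp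
  ultimately show ?thesis unfolding findim_def by blast
qed

lemma bop_on_nth: "bop_on (vecJ J) (dirsum X) J (X i) (\<lambda>x. x $ i)"
  unfolding bop_on_def lin_on_def
  by (auto simp: vecJ_def dirsum_def norm_component_le intro!: exI[of _ 1])

lemma bop_on_axis:
  fixes X :: "'n::finite \<Rightarrow> 'a::real_normed_vector set"
  assumes J: "linear J" and X: "\<And>i. subspace (X i)"
  shows "bop_on J (X i) (vecJ J) (dirsum X) (axis i)"
proof -
  have "bop_on J (X i) J (X j) (\<lambda>x. if j = i then x else 0)" for j
    using bop_on_id[of J "X i"] bop_on_zero[OF J X] by (cases "j = i") auto
  then show ?thesis
    unfolding axis_def by (rule bop_on_vec_lambda)
qed

text \<open>The entries are arbitrary, so that z - D and -A can be substituted later and the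
  spectral parameter disappears. Index 1 becomes \<open>Min UNIV\<close>.\<close>

locale triangular =
  fixes J :: "'a::banach \<Rightarrow> 'a"
    and X :: "'n::{finite,linorder} \<Rightarrow> 'a set"
    and D :: "'n \<Rightarrow> 'a \<Rightarrow> 'a"
    and A :: "'n \<Rightarrow> 'n \<Rightarrow> 'a \<Rightarrow> 'a"
  assumes J: "cstruct J"
    and X: "\<And>i. csubspace J (X i)" "\<And>i. closed (X i)"
    and D: "\<And>i. bop_on J (X i) J (X i) (D i)"
    and A: "\<And>i j. i < j \<Longrightarrow> bop_on J (X j) J (X i) (A i j)"
begin

abbreviation "T \<equiv> triOp D A"
abbreviation "Z \<equiv> dirsum X"

lemmas lJ = cstructD(2)[OF J]
lemmas sX = csubspaceD(1)[OF X(1)]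
lemmas cZ = csubspace_dirsum[of J X, OF X(1)]
lemmas sZ = csubspaceD(1)[OF cZ]
lemmas clZ = closed_dirsum[of X, OF X(2)]
lemmas cJZ = cstruct_vecJ[OF J, where 'n = 'n]
lemmas A0 = lin_onD(3)[OF bop_on_lin[OF A] sX]
lemmas D0 = lin_onD(3)[OF bop_on_lin[OF D] sX]

lemma bop_on_triOp: "bop_on (vecJ J) Z (vecJ J) Z T"
  unfolding triOp_def
  by (intro bop_on_vec_lambda bop_on_add[OF _ _ lJ sX] bop_on_sum[OF lJ sX]
      bop_on_comp[OF D bop_on_nth] bop_on_comp[OF A bop_on_nth]) simp

lemma triOp_left_fredholm_iff: "left_fredholm (vecJ J) Z Z T \<longleftrightarrow> left_regular (vecJ J) Z Z T"
  by (rule left_fredholm_iff_left_regular[OF cJZ cZ clZ cZ clZ bop_on_triOp])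

lemma diagonal_left_fredholm_iff:
  "left_fredholm J (X i) (X i) (D i) \<longleftrightarrow> left_regular J (X i) (X i) (D i)"
  by (rule left_fredholm_iff_left_regular[OF J X X D])

text \<open>K is strictly upper triangular, so iterating V \<mapsto> I - K V makes V a left inverse
  of I + K on one more coordinate from the bottom each time. It is the finite Neumann
  series.\<close>

lemma back_substitution:
  assumes K: "bop_on (vecJ J) Z (vecJ J) Z K"
    and upper: "\<And>x i. x \<in> Z \<Longrightarrow> (\<And>j. i < j \<Longrightarrow> x $ j = 0) \<Longrightarrow> K x $ i = 0"
  obtains V where "bop_on (vecJ J) Z (vecJ J) Z V" "\<And>x. x \<in> Z \<Longrightarrow> V (x + K x) = x"
proof -
  have lJZ: "linear (vecJ J :: ('a, 'n) vec \<Rightarrow> ('a, 'n) vec)"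
    by (rule linear_vecJ[OF lJ])
  \<comment> \<open>The condition card {j. i \<le> j} \<le> m says that i is among the last m
    indices; for m = 0 it is void, as i itself is counted.\<close>
  have "\<exists>V. bop_on (vecJ J) Z (vecJ J) Z V \<and>
      (\<forall>x\<in>Z. \<forall>i. card {j. i \<le> j} \<le> m \<longrightarrow> (V (x + K x) - x) $ i = 0)" for m
  proof (induction m)
    case 0
    have "card {j. i \<le> j} \<noteq> 0" for i :: 'n by auto
    then show ?case using bop_on_id by auto
  next
    case (Suc m)
    then obtain V where V: "bop_on (vecJ J) Z (vecJ J) Z V"
      "\<And>x i. x \<in> Z \<Longrightarrow> card {j. i \<le> j} \<le> m \<Longrightarrow> (V (x + K x) - x) $ i = 0" by blast
    have "bop_on (vecJ J) Z (vecJ J) Z (\<lambda>y. y - K (V y))"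
      by (rule bop_on_diff[OF bop_on_id bop_on_comp[OF K V(1)] lJZ sZ])
    moreover have "(x + K x - K (V (x + K x)) - x) $ i = 0"
      if x: "x \<in> Z" and i: "card {j. i \<le> j} \<le> Suc m" for x i
    proof -
      have e: "V (x + K x) \<in> Z"
        using x by (intro bop_on_in[OF V(1)] subspace_add[OF sZ] bop_on_in[OF K])
      have "K (V (x + K x) - x) $ i = 0"
      proof (rule upper)
        show "V (x + K x) - x \<in> Z" using e x by (rule subspace_diff[OF sZ])
        fix j assume "i < j"
        then have "{k. j \<le> k} \<subseteq> {k. i \<le> k}" "i \<in> {k. i \<le> k}" "i \<notin> {k. j \<le> k}" by auto
        then have "{k. j \<le> k} \<subset> {k. i \<le> k}" by blast
        then have "card {k. j \<le> k} < card {k. i \<le> k}" by (intro psubset_card_mono) auto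
        then show "(V (x + K x) - x) $ j = 0" using V(2)[OF x] i by simp
      qed
      then show ?thesis
        using lin_onD(5)[OF bop_on_lin[OF K] sZ e x] by simp
    qed
    ultimately show ?case by blast
  qed
  from this[of "CARD('n)"] obtain V where V: "bop_on (vecJ J) Z (vecJ J) Z V"
    "\<And>x i. x \<in> Z \<Longrightarrow> card {j. i \<le> j} \<le> CARD('n) \<Longrightarrow> (V (x + K x) - x) $ i = 0" by blast
  have "V (x + K x) = x" if "x \<in> Z" for x
    using V(2)[OF that] by (simp add: vec_eq_iff card_mono)
  with V(1) that show ?thesis by blast
qed

text \<open>The diagonal S0 of left inverses satisfies S0 T = I + K - F with K strictly upper
  triangular and F diagonal of finite rank. Applying V with V (I + K) = I gives V S0 T = I - V
  F.\<close>

lemma triOp_left_regular: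
  assumes reg: "\<And>i. left_regular J (X i) (X i) (D i)"
  shows "left_regular (vecJ J) Z Z T"
proof -
  obtain S where S: "\<And>i. bop_on J (X i) J (X i) (S i)"
    "\<And>i. findim ((\<lambda>x. x - S i (D i x)) ` X i)"
    using reg unfolding left_regular_def by metis
  define S0 where "S0 y = (\<chi> i. S i (y $ i))" for y
  define K where "K x = (\<chi> i. \<Sum>j\<in>{j. i < j}. S i (A i j (x $ j)))" for x
  define F where "F x = (\<chi> i. x $ i - S i (D i (x $ i)))" for x
  have S0: "bop_on (vecJ J) Z (vecJ J) Z S0"
    unfolding S0_def by (intro bop_on_vec_lambda bop_on_comp[OF S(1) bop_on_nth])
  have K: "bop_on (vecJ J) Z (vecJ J) Z K"
    unfolding K_def
    by (intro bop_on_vec_lambda bop_on_sum[OF lJ sX]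
        bop_on_comp[OF S(1) bop_on_comp[OF A bop_on_nth]]) simp
  have F: "bop_on (vecJ J) Z (vecJ J) Z F"
    unfolding F_def
    by (intro bop_on_vec_lambda bop_on_diff[OF _ _ lJ sX] bop_on_nth
        bop_on_comp[OF S(1) bop_on_comp[OF D bop_on_nth]])
  have "K x $ i = 0" if "\<And>j. i < j \<Longrightarrow> x $ j = 0" for x i
    using that A0 lin_onD(3)[OF bop_on_lin[OF S(1)] sX] by (simp add: K_def)
  then obtain V where V: "bop_on (vecJ J) Z (vecJ J) Z V" "\<And>x. x \<in> Z \<Longrightarrow> V (x + K x) = x"
    using back_substitution[OF K] by blast
  have "x - V (S0 (T x)) = V (F x)" if x: "x \<in> Z" for x
  proof -
    have xi: "x $ j \<in> X j" for j using x by (simp add: dirsum_def)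
    have "S0 (T x) $ i = ((x + K x) - F x) $ i" for i
    proof -
      \<comment> \<open>Membership of the partial sums in X i is proved along with the identity,
        since S i is additive only on X i.\<close>
      have "S i (\<Sum>j\<in>I. A i j (x $ j)) = (\<Sum>j\<in>I. S i (A i j (x $ j)))"
        "(\<Sum>j\<in>I. A i j (x $ j)) \<in> X i" if "I \<subseteq> {j. i < j}" for I
        using finite[of I] that
      proof (induction I rule: finite_induct)
        case empty
        {
          case 1
          then show ?case using lin_onD(3)[OF bop_on_lin[OF S(1)] sX] by simp
        next
          case 2
          then show ?case using subspace_0[OF sX] by simp
        }
      next
        case (insert j I)
        {
          case 1
          then show ?case
            using insert bop_on_in[OF A xi] by (simp add: lin_onD(1)[OF bop_on_lin[OF S(1)] sX])
        next
          case 2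
          then show ?case
            using insert bop_on_in[OF A xi] by (simp add: subspace_add[OF sX])
        }
      qed
      then show ?thesis
        using bop_on_in[OF D xi] lin_onD(1)[OF bop_on_lin[OF S(1)] sX]
        by (simp add: S0_def triOp_def K_def F_def)
    qed
    then have "S0 (T x) = (x + K x) - F x" by (simp add: vec_eq_iff)
    moreover have "x + K x \<in> Z" "F x \<in> Z"
      using x bop_on_in[OF F] bop_on_in[OF K] subspace_add[OF sZ] by auto
    ultimately show ?thesis
      using lin_onD(5)[OF bop_on_lin[OF V(1)] sZ] V(2)[OF x] by simp
  qed
  then have "(\<lambda>x. x - V (S0 (T x))) ` Z = V ` F ` Z"
    by (simp add: image_image)
  moreover have "findim (V ` F ` Z)"
  proof (rule findim_image[OF subspace_image_on[OF sZ bop_on_lin[OF F]]])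
    show "lin_on (F ` Z) V"
      using bop_on_in[OF F] by (intro lin_on_subset[OF bop_on_lin[OF V(1)]]) auto
    show "findim (F ` Z)"
      by (rule findim_subset[OF findim_dirsum[of "\<lambda>i. (\<lambda>x. x - S i (D i x)) ` X i", OF S(2)]])
        (auto simp: F_def dirsum_def)
  qed
  ultimately show ?thesis
    unfolding left_regular_def using bop_on_comp[OF V(1) S0] by auto
qed

text \<open>The first column of T has no entry besides the diagonal one, so T maps the first
  coordinate subspace into itself and acts there as the first diagonal entry. Restricting I - S T to
  it and taking the first coordinate keeps finite rank.\<close>

lemma corner_left_regular:
  assumes reg: "left_regular (vecJ J) Z Z T"
  shows "left_regular J (X (Min UNIV)) (X (Min UNIV)) (D (Min UNIV))"
proof -
  let ?m = "Min UNIV :: 'n"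
  obtain S where S: "bop_on (vecJ J) Z (vecJ J) Z S" "findim ((\<lambda>x. x - S (T x)) ` Z)"
    using reg by (auto simp: left_regular_def)
  note axis = bop_on_axis[of J X, OF lJ sX]
  have aZ: "axis ?m x \<in> Z" if "x \<in> X ?m" for x
    by (rule bop_on_in[OF axis that])
  have "T (axis ?m x) = axis ?m (D ?m x)" for x
  proof -
    have "(\<Sum>j\<in>{j. i < j}. A i j (axis ?m x $ j)) = 0" for i
    proof (rule sum.neutral, safe)
      fix j assume "i < j"
      then have "j \<noteq> ?m" using Min_le[of UNIV i] by auto
      then show "A i j (axis ?m x $ j) = 0" using A0[OF \<open>i < j\<close>] by (simp add: axis_def)
    qed
    then show ?thesis using D0 by (auto simp: triOp_def vec_eq_iff axis_def)
  qed
  then have eq: "x - S (axis ?m (D ?m x)) $ ?m = (axis ?m x - S (T (axis ?m x))) $ ?m" for x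
    by simp
  have "findim ((\<lambda>v. v $ ?m) ` (\<lambda>x. x - S (T x)) ` Z)"
  proof (rule findim_image[OF subspace_image_on[OF sZ] _ S(2)])
    show "lin_on Z (\<lambda>x. x - S (T x))"
      by (rule bop_on_lin[OF bop_on_diff[OF bop_on_id bop_on_comp[OF S(1) bop_on_triOp]
            linear_vecJ[OF lJ] sZ]])
    show "lin_on ((\<lambda>x. x - S (T x)) ` Z) (\<lambda>v. v $ ?m)" by (simp add: lin_on_def)
  qed
  then have "findim ((\<lambda>x. x - S (axis ?m (D ?m x)) $ ?m) ` X ?m)"
    unfolding eq by (rule findim_subset) (use aZ in blast)
  moreover have "bop_on J (X ?m) J (X ?m) (\<lambda>y. S (axis ?m y) $ ?m)"
    by (rule bop_on_comp[OF bop_on_nth bop_on_comp[OF S(1) axis]])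
  ultimately show ?thesis unfolding left_regular_def by blast
qed

lemma findim_ker_diagonal:
  assumes C: "\<And>s. s < k \<Longrightarrow> subspace (C s) \<and> findim (C s) \<and> (\<forall>y\<in>X s. \<exists>r\<in>D s ` X s. \<exists>c\<in>C s. y = r + c)"
    and ker: "findim {x \<in> Z. T x = 0}"
  shows "findim {x \<in> X k. D k x = 0}"
proof -
  \<comment> \<open>From row k on, T x is required to vanish exactly, so T maps M into a
    finite-dimensional direct sum.\<close>
  define E where "E i = (if i < k then C i else {0})" for i
  define M where "M = {x \<in> Z. (\<forall>j>k. x $ j = 0) \<and> T x \<in> dirsum E}"
  have sE: "subspace (E i)" for i
    using C by (simp add: E_def subspace_single_0)
  have fE: "findim (E i)" for i
    using C by (auto simp: E_def findim_def intro: exI[of _ "{}"])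
  note Tl = lin_onD[OF bop_on_lin[OF bop_on_triOp] sZ]
  have sM: "subspace M"
    using sZ sE unfolding M_def
    by (intro subspaceI) (auto simp: Tl subspace_add subspace_scale subspace_0 dirsum_def[of E])
  have "M \<subseteq> Z" by (auto simp: M_def)
  have "findim M"
  proof (rule findim_if_ker_image[OF sM])
    show "lin_on M T"
      by (rule lin_on_subset[OF bop_on_lin[OF bop_on_triOp] \<open>M \<subseteq> Z\<close>])
    show "findim (T ` M)"
      by (rule findim_subset[OF findim_dirsum[of E, OF fE]]) (auto simp: M_def)
    show "findim {x \<in> M. T x = 0}"
      by (rule findim_subset[OF ker]) (auto simp: M_def)
  qed
  have "u \<in> (\<lambda>x. x $ k) ` M" if u: "u \<in> X k" "D k u = 0" for u
  proof -
    \<comment> \<open>Rows are solved upwards from k: each new index b lies below all of I, so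
      changing the entry at b leaves the rows already treated unchanged.\<close>
    have "I \<subseteq> {s. s < k} \<Longrightarrow>
        \<exists>x\<in>Z. x $ k = u \<and> (\<forall>j>k. x $ j = 0) \<and> (\<forall>i\<in>I. T x $ i \<in> C i)" for I :: "'n set"
      using finite[of I]
    proof (induction I rule: finite_linorder_min_induct)
      case empty
      have "axis k u \<in> Z"
        by (rule bop_on_in[OF bop_on_axis[of J X, OF lJ sX] u(1)])
      then show ?case by (intro bexI[of _ "axis k u"]) (auto simp: axis_def)
    next
      case (insert b I)
      then obtain x where x: "x \<in> Z" "x $ k = u" "\<And>j. k < j \<Longrightarrow> x $ j = 0"
        "\<And>i. i \<in> I \<Longrightarrow> T x $ i \<in> C i" by auto
      have bk: "b < k" using insert.prems by auto
      have xj: "x $ j \<in> X j" for j using x(1) by (simp add: dirsum_def)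
      let ?v = "\<Sum>j\<in>{j. b < j}. A b j (x $ j)"
      have "?v \<in> X b" using bop_on_in[OF A xj] by (intro subspace_sum[OF sX]) auto
      then obtain r c where r: "r \<in> X b" "c \<in> C b" "?v = D b r + c"
        using C[OF bk] by blast
      \<comment> \<open>The later entries contribute D b r + c to row b; the entry -r cancels the
        first term and leaves c in C b.\<close>
      define x' where "x' = (\<chi> i. if i = b then - r else x $ i)"
      have above: "(\<Sum>j\<in>{j. i < j}. A i j (x' $ j)) = (\<Sum>j\<in>{j. i < j}. A i j (x $ j))"
        if "b \<le> i" for i
        using that by (intro sum.cong) (auto simp: x'_def)
      have "T x' $ b = D b (- r) + ?v"
        using above[of b] by (simp add: triOp_def x'_def)
      also have "\<dots> = c"
        using r lin_onD(4)[OF bop_on_lin[OF D] sX] by simp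
      finally have "T x' $ b \<in> C b" using r(2) by simp
      moreover have "T x' $ i \<in> C i" if "i \<in> I" for i
      proof -
        have "b < i" using insert that by blast
        then have "T x' $ i = T x $ i"
          using above[of i] by (auto simp: triOp_def x'_def)
        then show ?thesis using x(4)[OF that] by simp
      qed
      moreover have "x' \<in> Z"
        using xj r(1) subspace_neg[OF sX] by (simp add: dirsum_def x'_def)
      moreover have "x' $ k = u" "\<forall>j>k. x' $ j = 0"
        using x bk by (auto simp: x'_def)
      ultimately show ?case by blast
    qed
    from this[of "{s. s < k}"] obtain x where x: "x \<in> Z" "x $ k = u" "\<And>j. k < j \<Longrightarrow> x $ j = 0"
      "\<And>i. i < k \<Longrightarrow> T x $ i \<in> C i" by auto
    have "T x $ i = 0" if "\<not> i < k" for i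
    proof -
      have "(\<Sum>j\<in>{j. i < j}. A i j (x $ j)) = 0"
        using that x(3) A0 by (intro sum.neutral) auto
      moreover have "D i (x $ i) = 0"
        using that x(2,3) u(2) D0 by (cases "i = k") auto
      ultimately show ?thesis by (simp add: triOp_def)
    qed
    then have "T x $ i \<in> E i" for i
      using x(4) by (auto simp: E_def)
    then have "x \<in> M"
      using x by (auto simp: M_def dirsum_def[of E])
    with x(2) show ?thesis by blast
  qed
  then have "{x \<in> X k. D k x = 0} \<subseteq> (\<lambda>x. x $ k) ` M" by blast
  moreover have "findim ((\<lambda>x. x $ k) ` M)"
    by (rule findim_image[OF sM _ \<open>findim M\<close>]) (simp add: lin_on_def)
  ultimately show ?thesis by (rule findim_subset[rotated])
qed

end

text \<open>\<open>codim\<close> is an infimum over algebraic complements and is infinite if none of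
  them is finite-dimensional, so a finite value provides a finite-dimensional one.\<close>

lemma codim_finiteE:
  assumes "codim J Y R \<noteq> \<infinity>"
  obtains C where "csubspace J C" "C \<subseteq> Y" "findim C" "\<forall>y\<in>Y. \<exists>r\<in>R. \<exists>c\<in>C. y = r + c"
proof -
  define P where "P C \<longleftrightarrow> csubspace J C \<and> C \<subseteq> Y \<and> R \<inter> C = {0} \<and> (\<forall>y\<in>Y. \<exists>r\<in>R. \<exists>c\<in>C. y = r + c)" for C
  have "\<exists>C. P C \<and> cdim C \<noteq> \<infinity>"
  proof (rule ccontr)
    assume "\<not> ?thesis"
    then have "\<infinity> \<le> (INF C\<in>Collect P. cdim C)"
      by (intro INF_greatest) auto
    then show False using assms by (simp add: codim_def P_def[abs_def])
  qed
  then obtain C where "P C" "findim C"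
    using cdim_finite_iff by auto
  then show ?thesis using that[of C] unfolding P_def by blast
qed

section \<open>The essential spectrum\<close>

lemma bop_on_cscale:
  assumes J: "cstruct J" and X: "csubspace J X"
  shows "bop_on J X J X (cscale J z)"
proof -
  obtain K where "\<And>x. norm (J x) \<le> norm x * K"
    using bounded_linear.bounded[OF cstructD(1)[OF J]] by auto
  then have bJ: "bop_on J X J X J"
    using csubspaceD[OF X] cstructD(2)[OF J] unfolding bop_on_def lin_on_def
    by (auto simp: linear_add linear_scale mult.commute intro: exI[of _ K])
  have scale: "bop_on J X J X (\<lambda>x. r *\<^sub>R x)" for r
    using csubspaceD[OF X] cstructD(2)[OF J] unfolding bop_on_def lin_on_def
    by (auto simp: linear_scale subspace_scale scaleR_add_right intro: exI[of _ "\<bar>r\<bar>"])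
  show ?thesis
    unfolding cscale_def
    by (rule bop_on_add[OF scale bop_on_comp[OF scale bJ] cstructD(2)[OF J] csubspaceD(1)[OF X]])
qed

text \<open>\<open>sigma_le\<close> is defined by z - D, the two exceptional sets by D - z; the
  ranges agree because a subspace is closed under negation.\<close>

lemma shiftOp_image:
  assumes "subspace X" "lin_on X (\<lambda>x. cscale J z x - D x)"
  shows "shiftOp J D z ` X = (\<lambda>x. cscale J z x - D x) ` X"
proof -
  have "shiftOp J D z x = cscale J z (- x) - D (- x)" if "x \<in> X" for x
    using lin_onD(4)[OF assms(2,1) that] by (simp add: shiftOp_def)
  then show ?thesis
    using subspace_neg[OF assms(1)] by (force simp: image_iff)
qed

lemma alpha_shiftOp: "alpha X (shiftOp J D z) = alpha X (\<lambda>x. cscale J z x - D x)"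
proof -
  have "kerOp X (shiftOp J D z) = kerOp X (\<lambda>x. cscale J z x - D x)"
    by (auto simp: kerOp_def shiftOp_def)
  then show ?thesis by (simp add: alpha_def)
qed

lemma cscale_minus_triOp:
  "(\<lambda>x. cscale (vecJ J) z x - triOp D A x) = triOp (\<lambda>i x. cscale J z x - D i x) (\<lambda>i j x. - A i j x)"
  by (simp add: fun_eq_iff vec_eq_iff cscale_def vecJ_def triOp_def sum_negf)

theorem mainTheorem6:
  fixes J :: "'a::banach \<Rightarrow> 'a"
    and X :: "'n::{finite,linorder} \<Rightarrow> 'a set"
    and D :: "'n \<Rightarrow> 'a \<Rightarrow> 'a"
    and A :: "'n \<Rightarrow> 'n \<Rightarrow> 'a \<Rightarrow> 'a"
  assumes n2: "CARD('n) \<ge> 2"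
    and J: "cstruct J"
    and Xban: "\<And>k. csubspace J (X k) \<and> closed (X k)"
    and Dk: "\<And>k. cbop J (X k) (X k) (D k)"
    and cc: "\<And>s z. Min UNIV < s \<Longrightarrow> s < Max UNIV \<Longrightarrow>
               complements_condition J (X s) (X s) (shiftOp J (D s) z)"
    and Aij: "\<And>i j. i < j \<Longrightarrow> cbop J (X j) (X i) (A i j)"
  shows "(\<Union>k. sigma_le J (X k) (D k)) =
     sigma_le (vecJ J) (dirsum X) (triOp D A)
     \<union> ((\<Union>k\<in>{k. Min UNIV < k}.
          {z. alpha (X k) (shiftOp J (D k) z) = \<infinity>
             \<and> (\<forall>s. Min UNIV < s \<and> s < k \<longrightarrow> alpha (X s) (shiftOp J (D s) z) < \<infinity>)
             \<and> (\<Sum>s\<in>{s. s < k}. beta J (X s) (X s) (shiftOp J (D s) z)) = \<infinity>})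
        \<inter> rho_le J (X (Min UNIV)) (D (Min UNIV)))
     \<union> (\<Union>k. {z. (\<forall>s. alpha (X s) (shiftOp J (D s) z) < \<infinity>)
             \<and> \<not> complemented J (X k) (shiftOp J (D k) z ` X k)})"
  (is "?L = ?R1 \<union> ?R2 \<union> ?R3")
proof (rule set_eqI)
  fix z
  let ?m = "Min UNIV :: 'n"
  define E where "E i x = cscale J z x - D i x" for i x
  define B where "B i j x = - A i j x" for i j x
  have X: "csubspace J (X i)" "closed (X i)" and sX: "subspace (X i)" for i
    using Xban csubspaceD(1) by blast+
  have E: "bop_on J (X i) J (X i) (E i)" for i
    unfolding E_def using Dk
    by (intro bop_on_diff bop_on_cscale J X sX cstructD(2)[OF J]) (simp add: cbop_iff_bop_on)
  have B: "bop_on J (X j) J (X i) (B i j)" if "i < j" for i j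
    unfolding B_def using Aij[OF that]
    by (intro bop_on_uminus sX cstructD(2)[OF J]) (simp add: cbop_iff_bop_on)
  interpret triangular J X E B
    using J X E B by unfold_locales
  have im: "shiftOp J (D i) z ` X i = E i ` X i" for i
    using shiftOp_image[OF sX bop_on_lin[OF E[unfolded E_def]]] by (simp add: E_def[abs_def])
  have al: "alpha (X i) (shiftOp J (D i) z) = alpha (X i) (E i)" for i
    by (simp add: alpha_shiftOp E_def[abs_def])
  have sD: "z \<in> sigma_le J (X i) (D i) \<longleftrightarrow> \<not> left_fredholm J (X i) (X i) (E i)" for i
    by (simp add: sigma_le_def E_def[abs_def])
  have sT: "z \<in> ?R1 \<longleftrightarrow> \<not> left_fredholm (vecJ J) (dirsum X) (dirsum X) (triOp E B)"
    by (simp add: sigma_le_def cscale_minus_triOp E_def[abs_def] B_def[abs_def])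
  \<comment> \<open>Closedness of the range is already part of \<open>complemented\<close>, so a
    diagonal entry fails in just two ways: its kernel or its range.\<close>
  have lfD: "left_fredholm J (X i) (X i) (E i) \<longleftrightarrow>
      alpha (X i) (E i) < \<infinity> \<and> complemented J (X i) (E i ` X i)" for i
    by (auto simp: left_fredholm_def complemented_def)
  show "z \<in> ?L \<longleftrightarrow> z \<in> ?R1 \<union> ?R2 \<union> ?R3"
  proof
    assume "z \<in> ?R1 \<union> ?R2 \<union> ?R3"
    then consider "z \<in> ?R1" | "z \<in> ?R2" | "z \<in> ?R3" by blast
    then show "z \<in> ?L"
    proof cases
      case 1
      then have "\<exists>i. \<not> left_fredholm J (X i) (X i) (E i)"
        using triOp_left_regular
        unfolding sT triOp_left_fredholm_iff diagonal_left_fredholm_iff by blast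
      then show ?thesis using sD by blast
    next
      case 2
      then obtain k where "alpha (X k) (E k) = \<infinity>" by (auto simp: al)
      then have "\<not> left_fredholm J (X k) (X k) (E k)" by (simp add: lfD)
      then show ?thesis using sD by blast
    next
      case 3
      then obtain k where "\<not> complemented J (X k) (E k ` X k)" by (auto simp: im)
      then have "\<not> left_fredholm J (X k) (X k) (E k)" by (simp add: lfD)
      then show ?thesis using sD by blast
    qed
  next
    assume "z \<in> ?L"
    then obtain i where i: "\<not> left_fredholm J (X i) (X i) (E i)" using sD by blast
    show "z \<in> ?R1 \<union> ?R2 \<union> ?R3"
    proof (rule ccontr)
      assume not: "z \<notin> ?R1 \<union> ?R2 \<union> ?R3"
      then have lf: "left_fredholm (vecJ J) (dirsum X) (dirsum X) (triOp E B)"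
        using sT by blast
      then have lfm: "left_fredholm J (X ?m) (X ?m) (E ?m)"
        using corner_left_regular
        unfolding triOp_left_fredholm_iff diagonal_left_fredholm_iff by blast
      then have rho: "z \<in> rho_le J (X ?m) (D ?m)"
        using sD by (simp add: rho_le_def)
      \<comment> \<open>If I is empty, the failure at i can only come from the range, which places z
        in the last set. Otherwise its minimum is the index required by the middle set, and it
        exceeds the first index because the first entry is left Fredholm.\<close>
      define I where "I = {s. alpha (X s) (E s) = \<infinity>}"
      have "I \<noteq> {}"
      proof
        assume "I = {}"
        then have "alpha (X s) (E s) < \<infinity>" for s by (auto simp: I_def)
        moreover from this have "\<not> complemented J (X i) (E i ` X i)"
          using i by (simp add: lfD)
        ultimately have "z \<in> ?R3" by (intro UN_I[of i]) (simp_all add: al im)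
        with not show False by blast
      qed
      define k where "k = Min I"
      have k: "alpha (X k) (E k) = \<infinity>"
        using Min_in[of I] \<open>I \<noteq> {}\<close> by (auto simp: k_def I_def)
      have below: "alpha (X s) (E s) < \<infinity>" if "s < k" for s
      proof -
        have "s \<notin> I" using that Min_le[OF finite] unfolding k_def by (meson leD)
        then show ?thesis by (simp add: I_def)
      qed
      have "?m \<noteq> k" using lfm k by (auto simp: lfD)
      then have mk: "?m < k" using Min_le[OF finite UNIV_I, of k] by (rule le_neq_trans[rotated])
      have "(\<Sum>s\<in>{s. s < k}. beta J (X s) (X s) (shiftOp J (D s) z)) = \<infinity>"
      proof (rule ccontr)
        assume fin: "\<not> ?thesis"
        define Q where "Q s C \<longleftrightarrow> subspace C \<and> findim C \<and>
            (\<forall>y\<in>X s. \<exists>r\<in>E s ` X s. \<exists>c\<in>C. y = r + c)" for s C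
        have "\<exists>C. Q s C" if "s < k" for s
        proof -
          \<comment> \<open>In the extended naturals each summand is bounded by the sum, so a finite
            sum makes every codimension below k finite.\<close>
          have "beta J (X s) (X s) (shiftOp J (D s) z) \<le>
              (\<Sum>s\<in>{s. s < k}. beta J (X s) (X s) (shiftOp J (D s) z))"
            using that by (intro member_le_sum) auto
          then have "codim J (X s) (E s ` X s) \<noteq> \<infinity>"
            using fin unfolding beta_def im by (metis enat_ord_simps(5))
          then obtain C where C: "csubspace J C" "findim C"
              "\<forall>y\<in>X s. \<exists>r\<in>E s ` X s. \<exists>c\<in>C. y = r + c"
            by (rule codim_finiteE)
          then show ?thesis
            unfolding Q_def using csubspaceD(1)[OF C(1)] by (intro exI[of _ C] conjI)
        qed
        then obtain C where "\<And>s. s < k \<Longrightarrow> Q s (C s)"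
          by metis
        moreover have "findim {x \<in> dirsum X. triOp E B x = 0}"
          using lf alpha_finite_iff unfolding left_fredholm_def by blast
        ultimately have "alpha (X k) (E k) < \<infinity>"
          unfolding alpha_finite_iff Q_def by (rule findim_ker_diagonal)
        with k show False by simp
      qed
      with mk k below rho have "z \<in> ?R2" by (auto simp: al)
      with not show False by blast
    qed
  qed
qed

end
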